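(* There exists $A \subset \mathbb{N}_0$ with $A^2 + A^2 = \mathbb{N}_0$ and $A(X) = O\!\left(\frac{\sqrt{X}}{(\log X)^{1/4}}\right)$ as $X\to\infty$.
   Context: $\mathbb{N}_0$ is the set of nonnegative integers. $A^2=\{ab: a,b\in A\}$ and $A^2+A^2=\{x+y: x,y\in A^2\}$. $A(X)=|A\cap[1,X]|$. *)

theory Defs
  imports Complex_Main "HOL-Library.Landau_Symbols"
begin

definition prod_set :: "nat set \<Rightarrow> nat set" where
  "prod_set A = {a * b | a b. a \<in> A \<and> b \<in> A}"

definition sum_set :: "nat set \<Rightarrow> nat set" where
  "sum_set B = {x + y | x y. x \<in> B \<and> y \<in> B}"

definition count_fun :: "nat set \<Rightarrow> real \<Rightarrow> nat" where
  "count_fun A X = card {n \<in> A. 1 \<le> real n \<and> real n \<le> X}"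

end

theory Submission
  imports Defs "HOL-Library.FuncSet" "HOL-Real_Asymp.Real_Asymp" "HOL-Number_Theory.Cong"
begin

text \<open>Write an odd number \<open>n\<close> with \<open>2 ^ k \<le> n < 2 ^ (k + 1)\<close> as \<open>m * b + m' * d\<close>, where \<open>m\<close>, \<open>m'\<close> and \<open>d\<close> are taken
  from explicit thin sets: the odd numbers in short intervals above powers of four, and the multiples of
  \<open>2 ^ (4 * Q)\<close> in short intervals above powers of two, where \<open>Q = 16 ^ r\<close> is comparable to \<open>k\<close>.
  Since \<open>n\<close> is odd, different choices of \<open>(m, m', d)\<close> give different \<open>b\<close>, so for each of about \<open>Q\<close> dyadic
  sizes of \<open>m\<close> there are at least a constant times \<open>Q powr (1/4) * sqrt (2 ^ k / m)\<close> admissible \<open>b\<close> of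
  size about \<open>2 ^ k / m\<close>. Choosing a constant times \<open>sqrt Y / Q powr (1/4)\<close> numbers of every dyadic size
  \<open>Y\<close> at random, one expects to hit the admissible \<open>b\<close> of a given \<open>n\<close> about \<open>Q\<close> times with a large implied
  constant, so some choice hits them for all odd \<open>n\<close> in a range \<open>2 ^ (64 * Q) \<le> n < 2 ^ (64 * (16 * Q))\<close>
  simultaneously. Taking \<open>Q = 16 ^ r\<close> makes \<open>Q powr (1/4) = 2 ^ r\<close>, so all cardinalities are powers of
  two. Closing the union of these sets under doubling disposes of the even \<open>n\<close>.\<close>

section \<open>Hitting sets by counting choice functions\<close>

text \<open>Union bound: for \<open>f\<close> uniform in \<open>PiE T U\<close> the coordinates are
  independent, so the product is the probability that \<open>f\<close> avoids \<open>C n\<close>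
  everywhere. If these probabilities sum to less than 1, some \<open>f\<close> hits every
  \<open>C n\<close>.\<close>

lemma exists_hitting_choice:
  fixes U :: "'s \<Rightarrow> 'a set" and C :: "'n \<Rightarrow> 'a set"
  assumes fin: "finite T" "finite N" "\<And>s. s \<in> T \<Longrightarrow> finite (U s)"
    and ne: "\<And>s. s \<in> T \<Longrightarrow> U s \<noteq> {}"
    and small: "(\<Sum>n\<in>N. \<Prod>s\<in>T. 1 - real (card (U s \<inter> C n)) / real (card (U s))) < 1"
  shows "\<exists>f\<in>PiE T U. \<forall>n\<in>N. \<exists>s\<in>T. f s \<in> C n"
proof (rule ccontr)
  assume "\<not> ?thesis"
  then have sub: "PiE T U \<subseteq> (\<Union>n\<in>N. PiE T (\<lambda>s. U s - C n))"
    by (fastforce simp: PiE_iff)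
  have finP: "finite (PiE T (\<lambda>s. U s - C n))" for n
    using fin by (intro finite_PiE) auto
  have pos: "real (card (U s)) > 0" if "s \<in> T" for s
    using fin ne that by (simp add: card_gt_0_iff)
  have cardP: "real (card (PiE T (\<lambda>s. U s - C n)))
      = (\<Prod>s\<in>T. real (card (U s))) * (\<Prod>s\<in>T. 1 - real (card (U s \<inter> C n)) / real (card (U s)))" for n
  proof -
    have "real (card (U s - C n))
        = real (card (U s)) * (1 - real (card (U s \<inter> C n)) / real (card (U s)))" if "s \<in> T" for s
    proof -
      have "card (U s - C n) = card (U s) - card (U s \<inter> C n)"
        using fin that by (subst card_Diff_subset_Int) auto
      moreover have "card (U s \<inter> C n) \<le> card (U s)"
        using fin that by (intro card_mono) auto
      ultimately show ?thesis
        using pos[OF that] by (simp add: field_simps of_nat_diff)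
    qed
    then show ?thesis
      using fin by (simp add: card_PiE prod.distrib[symmetric])
  qed
  have "card (PiE T U) \<le> (\<Sum>n\<in>N. card (PiE T (\<lambda>s. U s - C n)))"
    using card_mono[OF _ sub] card_UN_le[OF fin(2), of "\<lambda>n. PiE T (\<lambda>s. U s - C n)"] fin finP
    by (meson finite_UN le_trans)
  then have "real (card (PiE T U)) \<le> (\<Sum>n\<in>N. real (card (PiE T (\<lambda>s. U s - C n))))"
    by (metis of_nat_le_iff of_nat_sum)
  also have "\<dots> = (\<Prod>s\<in>T. real (card (U s))) *
      (\<Sum>n\<in>N. \<Prod>s\<in>T. 1 - real (card (U s \<inter> C n)) / real (card (U s)))"
    by (simp add: cardP sum_distrib_left)
  also have "\<dots> < (\<Prod>s\<in>T. real (card (U s))) * 1"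
    using small pos by (intro mult_strict_left_mono prod_pos) auto
  also have "\<dots> = real (card (PiE T U))"
    using fin by (simp add: card_PiE)
  finally show False by simp
qed

section \<open>Residue classes and coprime pairs of odd numbers\<close>

text \<open>As \<open>c\<close> is invertible modulo \<open>q\<close>, any two solutions agree
  modulo \<open>q\<close>, so each block of length \<open>q\<close> holds at most one; the extra 1
  is for the incomplete last block.\<close>

lemma card_residue_class_le:
  fixes a c q N u :: nat
  assumes "q > 0" "coprime c q"
  shows "card {x. x < N \<and> [a + c * x = u] (mod q)} \<le> N div q + 1"
proof -
  let ?X = "{x. x < N \<and> [a + c * x = u] (mod q)}"
  have "inj_on (\<lambda>x. x div q) ?X"
  proof (rule inj_onI)
    fix x y assume x: "x \<in> ?X" and y: "y \<in> ?X" and eq: "x div q = y div q"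
    have "[a + c * x = a + c * y] (mod q)"
      using x y by (auto intro: cong_trans cong_sym)
    then have "[c * x = c * y] (mod q)"
      by (simp add: cong_add_lcancel_nat)
    then have "[x = y] (mod q)"
      using assms(2) by (simp add: cong_mult_lcancel_nat)
    then show "x = y"
      using eq by (metis cong_def div_mult_mod_eq)
  qed
  moreover have "(\<lambda>x. x div q) ` ?X \<subseteq> {..N div q}"
    by (auto intro: div_le_mono)
  ultimately show ?thesis
    using card_inj_on_le[of "\<lambda>x. x div q" ?X "{..N div q}"] by simp
qed

text \<open>One solution below \<open>q\<close> and its translates by multiples of \<open>q\<close>
  meet each of the \<open>N div q\<close> complete blocks.\<close>

lemma card_residue_class_ge:
  fixes a c q N u :: nat
  assumes "q > 0" "coprime c q"
  shows "N div q \<le> card {x. x < N \<and> [a + c * x = u] (mod q)}"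
proof -
  let ?X = "{x. x < N \<and> [a + c * x = u] (mod q)}"
  obtain y0 where "[c * y0 = 1] (mod q)"
    using cong_solve_coprime_nat[OF assms(2)] by auto
  \<comment> \<open>Over the naturals \<open>(q - 1) * a\<close> stands for \<open>- a\<close>
    modulo \<open>q\<close>.\<close>
  then have x0: "[c * (y0 * (u + (q - 1) * a)) = u + (q - 1) * a] (mod q)"
    using cong_scalar_right[of "c * y0" 1 q] by (simp add: mult.assoc)
  define x0 where "x0 = y0 * (u + (q - 1) * a)"
  note x0 = x0[folded x0_def]
  define x1 where "x1 = x0 mod q"
  have x1: "x1 < q" using assms x1_def by simp
  have sol: "[a + c * (y * q + x1) = u] (mod q)" for y
  proof -
    have "[y * q + x1 = x0] (mod q)"
      by (simp only: x1_def cong_def mod_mult_self3 mod_mod_trivial)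
    then have "[c * (y * q + x1) = c * x0] (mod q)"
      by (rule cong_scalar_left)
    then have "[a + c * (y * q + x1) = a + (u + (q - 1) * a)] (mod q)"
      using x0 by (metis cong_add_lcancel_nat cong_trans)
    also have "a + (u + (q - 1) * a) = u + q * a"
      using assms by (cases q) auto
    also have "[u + q * a = u] (mod q)"
      by (simp only: cong_def mod_mult_self2)
    finally show ?thesis .
  qed
  have "(\<lambda>y. y * q + x1) ` {..<N div q} \<subseteq> ?X"
  proof clarify
    fix y assume "y < N div q"
    then have "(y + 1) * q \<le> N"
      by (simp only: Suc_eq_plus1[symmetric] Suc_le_eq less_eq_div_iff_mult_less_eq[OF assms(1), symmetric])
    then show "y * q + x1 < N \<and> [a + c * (y * q + x1) = u] (mod q)"
      using sol x1 by simp
  qed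
  moreover have "inj_on (\<lambda>y. y * q + x1) {..<N div q}"
    using assms by (auto simp: inj_on_def)
  ultimately show ?thesis
    using card_inj_on_le[of "\<lambda>y. y * q + x1" "{..<N div q}" ?X] by simp
qed

text \<open>Each dyadic block contributes at most 1.\<close>

lemma sum_inverse_less_power2: "(\<Sum>z\<in>{1..<2^n}. 1 / real z) \<le> real n"
proof (induction n)
  case 0
  then show ?case by simp
next
  case (Suc n)
  have "(\<Sum>z\<in>{2^n..<2^Suc n}. 1 / real z) \<le> (\<Sum>z\<in>{2^n..<2^Suc n::nat}. 1 / 2^n)"
    by (intro sum_mono divide_left_mono) (auto simp: of_nat_le_iff[of "2^n", simplified, symmetric])
  also have "\<dots> = 1" by simp
  finally have *: "(\<Sum>z\<in>{2^n..<2^Suc n}. 1 / real z) \<le> 1" .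
  have "(\<Sum>z\<in>{1..<2^Suc n}. 1 / real z) = (\<Sum>z\<in>{1..<2^n}. 1 / real z) + (\<Sum>z\<in>{2^n..<2^Suc n}. 1 / real z)"
    by (subst sum.atLeastLessThan_concat) auto
  then show ?case using * Suc by simp
qed

lemma sum_inverse_odd_squares: "(\<Sum>z\<in>{1..<N}. 1 / real (2*z+1)^2) \<le> 1/4"
proof -
  \<comment> \<open>Strengthened for the induction: the new term is at most
    \<open>1/4 * (1/N - 1/(N + 1))\<close>, which telescopes. \<open>max 1 N\<close> makes the bound
    0 for the empty ranges.\<close>
  have "(\<Sum>z\<in>{1..<N}. 1 / real (2*z+1)^2) \<le> 1/4 * (1 - 1 / real (max 1 N))"
  proof (induction N)
    case 0
    then show ?case by simp
  next
    case (Suc N)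
    show ?case
    proof (cases "N = 0")
      case True
      then show ?thesis by simp
    next
      case False
      then have N: "real N > 0" by simp
      have "1 / real (2*N+1)^2 \<le> 1 / (4 * (real N * (real N + 1)))"
        using N by (intro divide_left_mono) (auto simp: power2_eq_square algebra_simps intro!: mult_pos_pos add_pos_nonneg)
      also have "\<dots> = 1/4 * (1 / real N - 1 / (real N + 1))"
        using N by (simp add: field_simps)
      finally show ?thesis
        using Suc False N by (simp add: max_def algebra_simps)
    qed
  qed
  also have "\<dots> \<le> 1/4" by simp
  finally show ?thesis .
qed

text \<open>A pair that is not coprime has a common divisor \<open>q = 2 * z + 1\<close> with
  \<open>3 \<le> q < 2 ^ n\<close>, odd because \<open>a + 2 * x\<close> is. Each such
  \<open>q\<close> divides both entries of at most \<open>(h/q + 1) * (5/4 * h'/q)\<close> pairs;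
  summing over \<open>q\<close> leaves at most \<open>25/64 * h * h'\<close> bad pairs, within the
  allowed half.\<close>

lemma card_coprime_odd_pairs:
  fixes a a' h h' n :: nat
  assumes odd: "odd a" and lt: "a + 2 * h \<le> 2 ^ n" and h': "4 * 2 ^ n \<le> h'" and h: "16 * n \<le> h"
  shows "h * h' \<le> 2 * card {(x, x'). x < h \<and> x' < h' \<and> coprime (a + 2 * x) (a' + 2 * x')}"
proof -
  let ?G = "{(x, x'). x < h \<and> x' < h' \<and> coprime (a + 2 * x) (a' + 2 * x')}"
  let ?B = "{(x, x'). x < h \<and> x' < h' \<and> \<not> coprime (a + 2 * x) (a' + 2 * x')}"
  define X where "X q = {x. x < h \<and> [a + 2 * x = 0] (mod q)}" for q
  define X' where "X' q = {x. x < h' \<and> [a' + 2 * x = 0] (mod q)}" for q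
  have fX: "finite (X q)" "finite (X' q)" for q
    unfolding X_def X'_def by auto
  have sub: "?B \<subseteq> (\<Union>z\<in>{1..<2^n}. X (2*z+1) \<times> X' (2*z+1))"
  proof clarify
    fix x x' assume x: "x < h" "x' < h'" and nc: "\<not> coprime (a + 2 * x) (a' + 2 * x')"
    define g where "g = gcd (a + 2 * x) (a' + 2 * x')"
    have g: "g dvd a + 2 * x" "g dvd a' + 2 * x'" by (auto simp: g_def)
    have "odd (a + 2 * x)" using odd by simp
    then have "odd g" using g(1) dvd_trans by blast
    then obtain z where z: "g = 2 * z + 1" by (elim oddE)
    have "g \<noteq> 1" using nc by (simp add: g_def coprime_iff_gcd_eq_1)
    then have "z \<ge> 1" using z by simp
    moreover have "g \<le> a + 2 * x" using g(1) odd by (intro dvd_imp_le) (auto simp: odd_pos)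
    then have "g < 2 ^ n" using x lt by linarith
    then have "z < 2 ^ n" using z by linarith
    ultimately show "(x, x') \<in> (\<Union>z\<in>{1..<2^n}. X (2*z+1) \<times> X' (2*z+1))"
      using g x z by (auto simp: X_def X'_def cong_0_iff)
  qed
  \<comment> \<open>\<open>z\<close> runs up to \<open>2 ^ n\<close> to suit the harmonic sum, so
    \<open>q\<close> may exceed every \<open>a + 2 * x\<close>; these classes are empty.\<close>
  have empty: "X (2*z+1) = {}" if "2 ^ n \<le> 2*z+1" for z
    using that lt odd unfolding X_def
    by (auto simp: cong_0_iff dest!: dvd_imp_le[where n = "a + _"] intro: odd_pos)
  have bound: "real (card (X (2*z+1) \<times> X' (2*z+1)))
      \<le> 5/4 * h' * (h * (1 / real (2*z+1)^2) + 1 / real z)" if "z \<ge> 1" for z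
  proof (cases "2 ^ n \<le> 2*z+1")
    case True
    have "0 \<le> 5/4 * h' * (h * (1 / real (2*z+1)^2) + 1 / real z)"
      by (intro mult_nonneg_nonneg add_nonneg_nonneg) auto
    then show ?thesis by (simp only: empty[OF True]) simp
  next
    case False
    define q where "q = 2*z+1"
    have q: "q > 0" "coprime 2 q" by (auto simp: q_def)
    have "card (X q) \<le> h div q + 1" "card (X' q) \<le> h' div q + 1"
      unfolding X_def X'_def using card_residue_class_le[OF q] by auto
    then have "real (card (X q)) \<le> real (h div q) + 1" "real (card (X' q)) \<le> real (h' div q) + 1"
      by linarith+
    moreover have "real (h div q) \<le> real h / real q" "real (h' div q) \<le> real h' / real q"
      by (rule of_nat_div_le_of_nat)+
    \<comment> \<open>\<open>4 * q \<le> h'\<close> absorbs the incomplete block: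
      \<open>h'/q + 1 \<le> 5/4 * h'/q\<close>.\<close>
    moreover have "1 \<le> 1/4 * (real h' / real q)"
    proof -
      have "4 * q \<le> 4 * 2 ^ n" using False unfolding q_def by (intro mult_le_mono2) simp
      then have "4 * q \<le> h'" using h' by (rule le_trans)
      then have "4 * real q \<le> real h'" by linarith
      then show ?thesis using q(1) by (simp add: field_simps)
    qed
    ultimately have "real (card (X q)) \<le> h / q + 1" "real (card (X' q)) \<le> 5/4 * (h' / q)"
      by linarith+
    then have "real (card (X q)) * real (card (X' q)) \<le> (h / q + 1) * (5/4 * (h' / q))"
      by (intro mult_mono) auto
    also have "\<dots> = 5/4 * h' * (h * (1 / real q ^ 2) + 1 / real q)"
      using q(1) by (simp add: field_simps power2_eq_square)
    also have "\<dots> \<le> 5/4 * h' * (h * (1 / real q ^ 2) + 1 / real z)"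
      using that by (intro mult_left_mono add_left_mono divide_left_mono) (auto simp: q_def)
    finally show ?thesis by (simp add: card_cartesian_product q_def)
  qed
  have "real (card ?B) \<le> real (\<Sum>z\<in>{1..<2^n}. card (X (2*z+1) \<times> X' (2*z+1)))"
    using fX by (intro of_nat_mono order.trans[OF card_mono[OF _ sub] card_UN_le]) auto
  also have "\<dots> \<le> (\<Sum>z\<in>{1..<2^n}. 5/4 * h' * (h * (1 / real (2*z+1)^2) + 1 / real z))"
    unfolding of_nat_sum by (intro sum_mono bound) auto
  also have "\<dots> = 5/4 * h' * (h * (\<Sum>z\<in>{1..<2^n}. 1 / real (2*z+1)^2) + (\<Sum>z\<in>{1..<2^n}. 1 / real z))"
    by (simp only: sum_distrib_left sum.distrib distrib_left)
  also have "\<dots> \<le> 5/4 * h' * (h * (1/4) + real n)"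
    by (intro mult_left_mono add_mono sum_inverse_less_power2 sum_inverse_odd_squares) auto
  also have "\<dots> \<le> 5/4 * h' * (h * (1/4) + real h / 16)"
    using h by (intro mult_left_mono add_left_mono) auto
  also have "\<dots> \<le> real (h * h') / 2"
    by (simp add: field_simps)
  finally have B: "real (card ?B) \<le> real (h * h') / 2" .
  have un: "?G \<union> ?B = {..<h} \<times> {..<h'}" and int: "?G \<inter> ?B = {}" by auto
  have "finite (?G \<union> ?B)" unfolding un by simp
  then have "card (?G \<union> ?B) = card ?G + card ?B"
    using int by (intro card_Un_disjoint) (auto simp only: finite_Un)
  then have "card ?G + card ?B = h * h'"
    unfolding un by (simp add: card_cartesian_product)
  then show ?thesis using B by linarith
qed

section \<open>Recovering a solution from its last factor\<close>

lemma odd_mult_power2_inject: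
  fixes a b x y :: nat
  assumes "odd a" "odd b" "a * 2 ^ x = b * 2 ^ y"
  shows "a = b \<and> x = y"
  using assms
proof (induction x arbitrary: y)
  case 0
  then show ?case by (cases y) auto
next
  case (Suc x)
  then show ?case by (cases y) auto
qed

text \<open>Division by \<open>2 ^ J\<close> discards the remainders and leaves
  \<open>m * 2 ^ (j - J)\<close>, whose odd part and exponent are unique.\<close>

lemma odd_leading_part_inject:
  fixes m1 m2 :: nat
  assumes "odd m1" "odd m2" "m1 * 2 ^ j1 + r1 = m2 * 2 ^ j2 + r2"
    and "r1 < 2 ^ J" "r2 < 2 ^ J" "J \<le> j1" "J \<le> j2"
  shows "m1 = m2 \<and> j1 = j2"
proof -
  have "(m * 2 ^ j + s) div 2 ^ J = m * 2 ^ (j - J)" if "J \<le> j" "s < 2 ^ J" for m j s :: nat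
  proof -
    have "(2::nat) ^ j = 2 ^ (j - J) * 2 ^ J"
      using that by (simp flip: power_add)
    then have eq: "m * 2 ^ j + s = s + (m * 2 ^ (j - J)) * 2 ^ J"
      by simp
    show ?thesis unfolding eq using that by simp
  qed
  then have "m1 * 2 ^ (j1 - J) = m2 * 2 ^ (j2 - J)"
    using assms by metis
  then show ?thesis
    using odd_mult_power2_inject assms by (metis eq_diff_iff)
qed

text \<open>Since \<open>p1\<close> is even, \<open>b\<close> is odd, hence invertible modulo
  \<open>2 ^ a\<close>; there \<open>m1 * b\<close> and \<open>m2 * b\<close> both reduce to
  \<open>n\<close>, and both coefficients lie below the modulus.\<close>

lemma odd_sum_coefficient_unique:
  fixes m1 m2 b p1 p2 n :: nat
  assumes "odd n" "m1 * b + p1 = n" "m2 * b + p2 = n"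
    and "2 ^ a dvd p1" "2 ^ a dvd p2" "0 < a" "m1 < 2 ^ a" "m2 < 2 ^ a"
  shows "m1 = m2"
proof -
  have "even p1"
    using assms by (meson dvd_power dvd_trans)
  then have "odd b" using assms by auto
  then have "coprime b (2 ^ a)" by simp
  moreover have "[m1 * b = m2 * b] (mod 2 ^ a)"
  proof -
    have "[m1 * b + p1 = m1 * b + 0] (mod 2 ^ a)" "[m2 * b + p2 = m2 * b + 0] (mod 2 ^ a)"
      using assms by (intro cong_add; simp add: cong_0_iff)+
    then show ?thesis
      using assms(2,3) by (metis add.right_neutral cong_sym cong_trans)
  qed
  ultimately have "[m1 = m2] (mod 2 ^ a)"
    by (simp add: cong_mult_rcancel_nat)
  then show ?thesis
    using assms by (simp add: cong_less_modulus_unique_nat)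
qed

section \<open>Multipliers, cofactors and the number of last factors\<close>

text \<open>Supplies the hypothesis \<open>16 * n \<le> h\<close> of
  \<open>card_coprime_odd_pairs\<close> for \<open>n = 2 * e + 1\<close> and
  \<open>h = 2 ^ (e - r)\<close>. As \<open>2 ^ r \<le> e\<close>, it reduces to
  \<open>16 * e * (2 * e + 1) \<le> 2 ^ e\<close>, valid from \<open>e = 16\<close> on.\<close>

lemma linear_le_power2_diff:
  fixes e r :: nat
  assumes "r \<ge> 1" "16 ^ r \<le> e"
  shows "16 * (2 * e + 1) \<le> 2 ^ (e - r)"
proof -
  have "(16::nat) ^ 1 \<le> 16 ^ r" using assms by (intro power_increasing) auto
  then have "16 \<le> e" using assms by simp
  then have "16 * e * (2 * e + 1) \<le> 2 ^ e"
  proof (induction e rule: nat_induct_at_least)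
    case (Suc e)
    have "16 * e \<le> e * e" using Suc by (intro mult_le_mono1)
    then have "3 * e + 3 \<le> 2 * (e * e)" using Suc(1) by linarith
    then have "16 * Suc e * (2 * Suc e + 1) \<le> 2 * (16 * e * (2 * e + 1))" by (simp add: algebra_simps)
    also have "\<dots> \<le> 2 ^ Suc e" using Suc by simp
    finally show ?case .
  qed simp
  have "r < 2 ^ r" by simp
  have "(2::nat) ^ r \<le> 16 ^ r" by (intro power_mono) auto
  with assms \<open>r < 2 ^ r\<close> have r: "2 ^ r \<le> e" "r \<le> e" by linarith+
  have "2 ^ r * (16 * (2 * e + 1)) \<le> e * (16 * (2 * e + 1))"
    using r by (intro mult_le_mono1)
  also have "\<dots> \<le> 2 ^ e" using \<open>16 * e * (2 * e + 1) \<le> 2 ^ e\<close> by (simp add: algebra_simps)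
  also have "\<dots> = 2 ^ r * 2 ^ (e - r)" using r by (simp flip: power_add)
  finally show ?thesis by simp
qed

definition multiplier :: "nat \<Rightarrow> nat \<Rightarrow> nat" where
  "multiplier e x = 2 ^ (2 * e) + 1 + 2 * x"

text \<open>\<open>2 ^ (4 * Q)\<close> exceeds every multiplier in use with
  \<open>e < 2 * Q\<close>, so such a multiplier can be recovered modulo it; the leading
  \<open>2 ^ j\<close> makes \<open>j\<close> recoverable.\<close>

definition cofactor :: "nat \<Rightarrow> nat \<Rightarrow> nat \<Rightarrow> nat" where
  "cofactor Q j t = 2 ^ j + 2 ^ (4 * Q) * t"

lemma odd_multiplier: "e > 0 \<Longrightarrow> odd (multiplier e x)"
  by (simp add: multiplier_def)

lemma multiplier_less:
  assumes "x < 2 ^ (e - r)" "1 \<le> r" "1 \<le> e"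
  shows "multiplier e x < 2 ^ (2 * e + 1)"
proof -
  have "x + 1 \<le> 2 ^ (e - r)" using assms by simp
  also have "\<dots> \<le> 2 ^ (2 * e - 1)" using assms by (intro power_increasing) auto
  finally have "2 * (x + 1) \<le> 2 * 2 ^ (2 * e - 1)" by simp
  also have "\<dots> = 2 ^ (2 * e)" using assms by (simp flip: power_Suc)
  finally show ?thesis by (simp add: multiplier_def)
qed

text \<open>For odd \<open>n\<close> the number \<open>b\<close> determines the whole solution: the cofactors are divisible by a
  power of two exceeding every multiplier, so \<open>b\<close> is odd and the first multiplier is read off modulo
  that power; the second product is an odd multiple of \<open>2 ^ j\<close> up to a relatively tiny error.\<close>
lemma card_last_factor_ge:
  fixes r e k n :: nat
  defines "Q \<equiv> 16 ^ r"
  assumes r: "1 \<le> r" and e: "Q \<le> e" "e < 2 * Q" and k: "64 * Q \<le> k"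
    and n: "odd n" "2 ^ k \<le> n" "n < 2 ^ (k + 1)"
  shows "2 ^ ((k - 3) div 2 - e + r - 2) \<le>
    card {b \<in> {2 ^ (k - 2 - 2 * e)..<2 ^ (k + 1 - 2 * e)}.
      \<exists>x<2 ^ (e - r). \<exists>e'\<in>{5 * Q..<6 * Q}. \<exists>x'<2 ^ (e' - r). \<exists>t<2 ^ ((k - 3 - 2 * e') div 2 - r).
        multiplier e x * b + multiplier e' x' * cofactor Q (k - 3 - 2 * e') t = n}" (is "_ \<le> card ?C")
proof -
  have "r < 2 ^ r" "(2::nat) ^ r \<le> 16 ^ r" by (auto intro: power_mono)
  then have rQ: "r + 1 \<le> Q" unfolding Q_def by linarith
  have "(16::nat) ^ 1 \<le> 16 ^ r" using r by (intro power_increasing) auto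
  then have Q16: "16 \<le> Q" by (simp add: Q_def)
  define \<kappa> where "\<kappa> = (k - 3) div 2"
  have \<kappa>: "2 * \<kappa> \<le> k - 3" "k - 3 \<le> 2 * \<kappa> + 1" unfolding \<kappa>_def by auto
  have \<kappa>': "(k - 3 - 2 * e') div 2 = \<kappa> - e'" for e' unfolding \<kappa>_def by auto
  \<comment> \<open>The shift by 3 gives a second product below
    \<open>2 ^ (2 * e' + 1) * 2 ^ (j e' + 1) = 2 ^ (k - 1)\<close>, so at least half of
    \<open>n\<close> is left for the first product.\<close>
  define j where "j e' = k - 3 - 2 * e'" for e'
  \<comment> \<open>From \<open>5 * Q\<close> on, \<open>2 * e + 3 \<le> e' - r\<close>, as the
    count of coprime pairs requires; the bound \<open>6 * Q\<close> keeps every \<open>j e'\<close>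
    at or above \<open>k - 3 - 12 * Q\<close>.\<close>
  define E where "E = {5 * Q..<6 * Q}"
  define G where "G e' = {(x, x'). x < 2 ^ (e - r) \<and> x' < 2 ^ (e' - r)
    \<and> coprime (multiplier e x) (multiplier e' x')}" for e'
  \<comment> \<open>The congruence says that the first multiplier divides what remains of
    \<open>n\<close>; for a coprime pair it confines \<open>t\<close> to a single residue
    class.\<close>
  define T where "T e' p = {t. t < 2 ^ (\<kappa> - e' - r) \<and>
    [multiplier e' (snd p) * 2 ^ j e' + (multiplier e' (snd p) * 2 ^ (4 * Q)) * t = n]
      (mod multiplier e (fst p))}" for e' p
  define S where "S = Sigma E (\<lambda>e'. Sigma (G e') (T e'))"
  define f where "f = (\<lambda>(e', (x, x'), t).
    (n - multiplier e' x' * cofactor Q (j e') t) div multiplier e x)"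
  have Ebounds: "5 * Q \<le> e'" "e' < 6 * Q" "e' > 0" if "e' \<in> E" for e'
    using that Q16 by (auto simp: E_def)
  have finG: "finite (G e')" for e'
    by (rule finite_subset[of _ "{..<2 ^ (e - r)} \<times> {..<2 ^ (e' - r)}"]) (auto simp: G_def)
  have finT: "finite (T e' p)" for e' p
    unfolding T_def by auto
  have cG: "2 ^ (e - r) * 2 ^ (e' - r) \<le> 2 * card (G e')" if "e' \<in> E" for e'
    unfolding G_def multiplier_def
  proof (rule card_coprime_odd_pairs[where n = "2 * e + 1"])
    show "odd (2 ^ (2 * e) + 1 :: nat)" using e Q16 by simp
    have "e - r + 1 \<le> 2 * e - 1" using e Q16 r by linarith
    then have "(2::nat) ^ (e - r + 1) \<le> 2 ^ (2 * e - 1)" by (intro power_increasing) auto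
    moreover have "2 ^ (2 * e) = 2 * (2::nat) ^ (2 * e - 1)" using e Q16 by (simp flip: power_Suc)
    moreover have "1 \<le> (2::nat) ^ (2 * e - 1)" by simp
    ultimately have "1 + 2 * 2 ^ (e - r) \<le> (2::nat) ^ (2 * e)"
      unfolding power_add power_one_right by linarith
    then show "2 ^ (2 * e) + 1 + 2 * 2 ^ (e - r) \<le> (2::nat) ^ (2 * e + 1)" by simp
    have "2 * e + 3 \<le> e' - r" using e Ebounds[OF that] rQ by linarith
    then have "(2::nat) ^ (2 * e + 3) \<le> 2 ^ (e' - r)" by (intro power_increasing) auto
    then show "4 * 2 ^ (2 * e + 1) \<le> (2::nat) ^ (e' - r)" by (simp add: power_add)
    show "16 * (2 * e + 1) \<le> 2 ^ (e - r)"
      using linear_le_power2_diff r e by (simp add: Q_def)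
  qed
  have cT: "2 ^ (\<kappa> - e' - r - (2 * e + 1)) \<le> card (T e' p)" if e': "e' \<in> E" and pG: "p \<in> G e'" for e' p
  proof -
    obtain x x' where p: "p = (x, x')" "x < 2 ^ (e - r)" "coprime (multiplier e x) (multiplier e' x')"
      using pG by (auto simp: G_def)
    have odd: "odd (multiplier e x)" using odd_multiplier e Q16 by simp
    have cop: "coprime (multiplier e' x' * 2 ^ (4 * Q)) (multiplier e x)"
      using p odd by (simp add: coprime_commute)
    have pos: "multiplier e x > 0" using odd by (rule odd_pos)
    have le: "multiplier e x \<le> 2 ^ (2 * e + 1)"
      using multiplier_less[OF p(2) r] e Q16 by simp
    have "2 * e + 1 \<le> \<kappa> - e' - r"
      using e Ebounds[OF e'] rQ k \<kappa> Q16 by linarith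
    then have "2 ^ (\<kappa> - e' - r - (2 * e + 1)) = 2 ^ (\<kappa> - e' - r) div (2::nat) ^ (2 * e + 1)"
      by (rule power_diff[rotated]) simp
    also have "\<dots> \<le> 2 ^ (\<kappa> - e' - r) div multiplier e x"
      using le pos by (intro div_le_mono2)
    also have "\<dots> \<le> card (T e' p)"
      unfolding T_def p fst_conv snd_conv by (rule card_residue_class_ge[OF pos cop])
    finally show ?thesis .
  qed
  \<comment> \<open>The thinned ranges of \<open>x\<close>, \<open>x'\<close> and \<open>t\<close>
    each lose a factor \<open>2 ^ r\<close>, while the \<open>Q = 2 ^ (4 * r)\<close> values of
    \<open>e'\<close> win four such factors; the net gain is \<open>2 ^ r\<close>.\<close>
  have "2 * 2 ^ (\<kappa> - e + r - 2) \<le> 2 * card S"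
  proof -
    have "2 * 2 ^ (\<kappa> - e + r - 2) = (2::nat) ^ (\<kappa> - e + r - 1)"
      using e k \<kappa> Q16 rQ by (subst power_Suc[symmetric]) (rule arg_cong[where f = "\<lambda>x. 2 ^ x"], linarith)
    also have "\<dots> = (\<Sum>e'\<in>E. 2 ^ (e - r) * 2 ^ (e' - r) * 2 ^ (\<kappa> - e' - r - (2 * e + 1)))"
    proof -
      have "2 ^ (e - r) * 2 ^ (e' - r) * 2 ^ (\<kappa> - e' - r - (2 * e + 1))
          = (2::nat) ^ (\<kappa> - e - 3 * r - 1)" if "e' \<in> E" for e'
        unfolding power_add[symmetric] using e k \<kappa> Q16 rQ Ebounds[OF that]
        by (intro arg_cong[where f = "\<lambda>x. 2 ^ x"]) linarith
      then have "(\<Sum>e'\<in>E. 2 ^ (e - r) * 2 ^ (e' - r) * 2 ^ (\<kappa> - e' - r - (2 * e + 1)))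
          = Q * (2::nat) ^ (\<kappa> - e - 3 * r - 1)"
        by (simp add: E_def)
      also have "Q = 2 ^ (4 * r)" unfolding Q_def by (simp add: power_mult)
      also have "2 ^ (4 * r) * (2::nat) ^ (\<kappa> - e - 3 * r - 1) = 2 ^ (\<kappa> - e + r - 1)"
        unfolding power_add[symmetric] using e k \<kappa> Q16 rQ
        by (intro arg_cong[where f = "\<lambda>x. 2 ^ x"]) linarith
      finally show ?thesis by simp
    qed
    also have "\<dots> \<le> (\<Sum>e'\<in>E. 2 * card (G e') * 2 ^ (\<kappa> - e' - r - (2 * e + 1)))"
      using cG by (intro sum_mono mult_le_mono1)
    also have "\<dots> = 2 * (\<Sum>e'\<in>E. \<Sum>p\<in>G e'. 2 ^ (\<kappa> - e' - r - (2 * e + 1)))"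
      by (simp add: sum_distrib_left mult.assoc)
    also have "\<dots> \<le> 2 * (\<Sum>e'\<in>E. \<Sum>p\<in>G e'. card (T e' p))"
      using cT by (intro mult_le_mono2 sum_mono)
    also have "\<dots> = 2 * card S"
      unfolding S_def using finG finT by (simp add: card_SigmaI E_def)
    finally show ?thesis .
  qed
  then have cS: "2 ^ (\<kappa> - e + r - 2) \<le> card S" by simp
  have sol: "multiplier e x < 2 ^ (2 * e + 1) \<and> multiplier e' x' < 2 ^ (2 * e' + 1)
      \<and> 2 ^ (4 * Q) dvd multiplier e' x' * cofactor Q (j e') t
      \<and> multiplier e' x' * (2 ^ (4 * Q) * t) < 2 ^ (k - 3 - 12 * Q)
      \<and> multiplier e x * f (e', (x, x'), t) + multiplier e' x' * cofactor Q (j e') t = n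
      \<and> f (e', (x, x'), t) \<in> ?C"
    if "(e', (x, x'), t) \<in> S" for e' x x' t
  proof -
    from that have e': "e' \<in> E" and x: "x < 2 ^ (e - r)" and x': "x' < 2 ^ (e' - r)"
      and t: "t < 2 ^ (\<kappa> - e' - r)"
      and cong: "[multiplier e' x' * cofactor Q (j e') t = n] (mod multiplier e x)"
      by (auto simp: S_def G_def T_def cofactor_def algebra_simps)
    note eb = Ebounds[OF e']
    have m: "multiplier e x < 2 ^ (2 * e + 1)" using multiplier_less[OF x r] e Q16 by simp
    have m': "multiplier e' x' < 2 ^ (2 * e' + 1)" using multiplier_less[OF x' r] eb by simp
    have s: "2 ^ (4 * Q) * t \<le> 2 ^ (4 * Q) * 2 ^ (\<kappa> - e' - r)" using t by simp
    also have "\<dots> = 2 ^ (4 * Q + (\<kappa> - e' - r))" by (simp add: power_add)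
    finally have s: "2 ^ (4 * Q) * t \<le> 2 ^ (4 * Q + (\<kappa> - e' - r))" .
    \<comment> \<open>The contribution of \<open>t\<close> stays below
      \<open>2 ^ (k - 3 - 12 * Q)\<close>, a power that divides every leading term
      \<open>multiplier e' x' * 2 ^ j e'\<close>; \<open>64 * Q \<le> k\<close> gives the
      room.\<close>
    have "multiplier e' x' * (2 ^ (4 * Q) * t) \<le> multiplier e' x' * 2 ^ (4 * Q + (\<kappa> - e' - r))"
      using s by (rule mult_le_mono2)
    also have "\<dots> < 2 ^ (2 * e' + 1) * 2 ^ (4 * Q + (\<kappa> - e' - r))"
      using m' by (intro mult_strict_right_mono) auto
    also have "\<dots> = 2 ^ (2 * e' + 1 + (4 * Q + (\<kappa> - e' - r)))" by (simp add: power_add)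
    also have "\<dots> \<le> 2 ^ (k - 3 - 12 * Q)"
      using eb k \<kappa> rQ r by (intro power_increasing) linarith+
    finally have small: "multiplier e' x' * (2 ^ (4 * Q) * t) < 2 ^ (k - 3 - 12 * Q)" .
    have "(2::nat) ^ (4 * Q + (\<kappa> - e' - r)) \<le> 2 ^ j e'"
      using eb k \<kappa> rQ r by (intro power_increasing) (auto simp: j_def)
    with s have "2 ^ (4 * Q) * t \<le> 2 ^ j e'" by (rule le_trans)
    then have cof: "cofactor Q (j e') t \<le> 2 ^ (j e' + 1)"
      by (simp add: cofactor_def)
    have dvd: "2 ^ (4 * Q) dvd cofactor Q (j e') t"
      unfolding cofactor_def using eb k Q16
      by (intro dvd_add le_imp_power_dvd) (auto simp: j_def)
    have "multiplier e' x' * cofactor Q (j e') t < 2 ^ (2 * e' + 1) * 2 ^ (j e' + 1)"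
      using m' cof by (intro mult_less_le_imp_less) (auto simp: cofactor_def)
    also have "\<dots> = 2 ^ (k - 1)"
      unfolding power_add[symmetric] using eb k
      by (intro arg_cong[where f = "\<lambda>x. 2 ^ x"]) (simp add: j_def)
    finally have p: "multiplier e' x' * cofactor Q (j e') t < 2 ^ (k - 1)" .
    have k2: "2 ^ k = 2 * (2::nat) ^ (k - 1)" using k Q16 by (simp flip: power_Suc)
    define b where "b = f (e', (x, x'), t)"
    have "multiplier e x dvd n - multiplier e' x' * cofactor Q (j e') t"
      using cong p n(2) k2 by (simp add: cong_altdef_nat cong_sym_eq)
    then have "multiplier e x * b = n - multiplier e' x' * cofactor Q (j e') t"
      by (simp add: f_def b_def)
    then have eq: "multiplier e x * b + multiplier e' x' * cofactor Q (j e') t = n"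
      using p n(2) k2 by simp
    \<comment> \<open>The first product lies between \<open>2 ^ (k - 1)\<close> and
      \<open>2 ^ (k + 1)\<close>; dividing by a multiplier between \<open>2 ^ (2 * e)\<close> and
      \<open>2 ^ (2 * e + 1)\<close> gives both ends of the window for \<open>b\<close>.\<close>
    have lo: "2 ^ (k - 1) < multiplier e x * b" using eq p n(2) k2 by linarith
    have "b \<ge> 2 ^ (k - 2 - 2 * e)"
    proof (rule ccontr)
      assume "\<not> ?thesis"
      then have "multiplier e x * b \<le> 2 ^ (2 * e + 1) * 2 ^ (k - 2 - 2 * e)"
        using m by (intro mult_le_mono) auto
      also have "\<dots> = 2 ^ (k - 1)"
        unfolding power_add[symmetric] using k e Q16
        by (intro arg_cong[where f = "\<lambda>x. 2 ^ x"]) linarith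
      finally show False using lo by simp
    qed
    moreover have "b < 2 ^ (k + 1 - 2 * e)"
    proof (rule ccontr)
      assume "\<not> ?thesis"
      then have "2 ^ (2 * e) * 2 ^ (k + 1 - 2 * e) \<le> multiplier e x * b"
        by (intro mult_le_mono) (auto simp: multiplier_def)
      also have "2 ^ (2 * e) * 2 ^ (k + 1 - 2 * e) = (2::nat) ^ (k + 1)"
        unfolding power_add[symmetric] using k e Q16
        by (intro arg_cong[where f = "\<lambda>x. 2 ^ x"]) linarith
      finally show False using eq n(3) by simp
    qed
    ultimately have "b \<in> {2 ^ (k - 2 - 2 * e)..<2 ^ (k + 1 - 2 * e)}" by simp
    then have "b \<in> ?C"
      using x x' t e' eq unfolding \<kappa>' E_def j_def by blast
    then show ?thesis
      using m m' dvd small eq unfolding b_def by simp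
  qed
  have "inj_on f S"
  proof (rule inj_onI)
    fix u v assume "u \<in> S" "v \<in> S" and fe: "f u = f v"
    obtain e1 x1 y1 t1 where u: "u = (e1, (x1, y1), t1)" by (metis prod.exhaust)
    obtain e2 x2 y2 t2 where v: "v = (e2, (x2, y2), t2)" by (metis prod.exhaust)
    note su = sol[OF \<open>u \<in> S\<close>[unfolded u]] and sv = sol[OF \<open>v \<in> S\<close>[unfolded v]]
    define b where "b = f u"
    define p1 where "p1 = multiplier e1 y1 * cofactor Q (j e1) t1"
    define p2 where "p2 = multiplier e2 y2 * cofactor Q (j e2) t2"
    have E12: "e1 \<in> E" "e2 \<in> E"
      using \<open>u \<in> S\<close> \<open>v \<in> S\<close> by (auto simp: S_def u v)
    have eqs: "multiplier e x1 * b + p1 = n" "multiplier e x2 * b + p2 = n"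
      using su sv fe unfolding b_def p1_def p2_def u v by auto
    have "(2::nat) ^ (2 * e + 1) \<le> 2 ^ (4 * Q)"
      using e by (intro power_increasing) auto
    then have m: "multiplier e x1 < 2 ^ (4 * Q)" "multiplier e x2 < 2 ^ (4 * Q)"
      using less_le_trans[OF su[THEN conjunct1]] less_le_trans[OF sv[THEN conjunct1]] by blast+
    have d: "2 ^ (4 * Q) dvd p1" "2 ^ (4 * Q) dvd p2"
      unfolding p1_def p2_def using su sv by blast+
    have mm: "multiplier e x1 = multiplier e x2"
      using odd_sum_coefficient_unique[OF n(1) eqs d _ m] Q16 by simp
    then have "x1 = x2" by (simp add: multiplier_def)
    have "p1 = p2" using eqs mm by simp
    then have pp: "multiplier e1 y1 * 2 ^ j e1 + multiplier e1 y1 * (2 ^ (4 * Q) * t1)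
        = multiplier e2 y2 * 2 ^ j e2 + multiplier e2 y2 * (2 ^ (4 * Q) * t2)"
      by (simp add: p1_def p2_def cofactor_def distrib_left)
    have J: "k - 3 - 12 * Q \<le> j e1" "k - 3 - 12 * Q \<le> j e2"
      unfolding j_def using Ebounds(2)[OF E12(1)] Ebounds(2)[OF E12(2)] by linarith+
    have sm: "multiplier e1 y1 * (2 ^ (4 * Q) * t1) < 2 ^ (k - 3 - 12 * Q)"
      "multiplier e2 y2 * (2 ^ (4 * Q) * t2) < 2 ^ (k - 3 - 12 * Q)"
      using su sv by blast+
    have "multiplier e1 y1 = multiplier e2 y2 \<and> j e1 = j e2"
      by (rule odd_leading_part_inject[OF odd_multiplier odd_multiplier pp sm J])
        (rule Ebounds(3)[OF E12(1)] Ebounds(3)[OF E12(2)])+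
    moreover have "j e1 = j e2 \<Longrightarrow> e1 = e2"
      using Ebounds[OF E12(1)] Ebounds[OF E12(2)] k by (simp add: j_def)
    ultimately have "e1 = e2" "multiplier e1 y1 = multiplier e2 y2" by auto
    then have "y1 = y2" by (simp add: multiplier_def)
    have "t1 = t2"
      using pp odd_multiplier[OF Ebounds(3)[OF E12(2)], of y2] \<open>e1 = e2\<close> \<open>y1 = y2\<close>
      by (auto dest: odd_pos)
    show "u = v" using u v \<open>e1 = e2\<close> \<open>x1 = x2\<close> \<open>y1 = y2\<close> \<open>t1 = t2\<close> by simp
  qed
  moreover have "f ` S \<subseteq> ?C" using sol by auto
  moreover have "finite ?C" by simp
  ultimately have "card S \<le> card ?C" by (rule card_inj_on_le)
  then show ?thesis using cS unfolding \<kappa>_def by linarith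
qed

section \<open>Geometric sums over dyadic sizes\<close>

lemma sum_power2_div2: "(\<Sum>i<m. 2 ^ (i div 2)) + 2 = 2 ^ (m div 2) + (2::nat) ^ ((m + 1) div 2)"
  by (induction m) auto

text \<open>Counts of order \<open>2 ^ (i div 2)\<close> grow geometrically, so the largest index
  dominates. The offset 3 is there because a part of index \<open>i\<close> reaches down to
  \<open>2 ^ (i - 3)\<close>: elements below \<open>2 ^ m\<close> have indices below
  \<open>m + 3\<close>.\<close>

lemma card_UN_power2_le:
  fixes S :: "nat \<Rightarrow> 'a set"
  assumes "I \<subseteq> {..<m + 3}" "\<And>i. i \<in> I \<Longrightarrow> 2 ^ r * card (S i) \<le> c * 2 ^ (i div 2)"
  shows "2 ^ r * card (\<Union>i\<in>I. S i) \<le> 8 * c * 2 ^ (m div 2)"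
proof -
  have fin: "finite I" using assms(1) finite_subset by blast
  have "2 ^ r * card (\<Union>i\<in>I. S i) \<le> (\<Sum>i\<in>I. 2 ^ r * card (S i))"
    using card_UN_le[OF fin] by (simp flip: sum_distrib_left)
  also have "\<dots> \<le> (\<Sum>i\<in>I. c * 2 ^ (i div 2))"
    using assms(2) by (rule sum_mono)
  also have "\<dots> \<le> (\<Sum>i<m + 3. c * 2 ^ (i div 2))"
    using assms(1) by (intro sum_mono2) auto
  also have "\<dots> = c * (\<Sum>i<m + 3. 2 ^ (i div 2))"
    by (simp add: sum_distrib_left)
  also have "\<dots> \<le> c * (8 * 2 ^ (m div 2))"
  proof (rule mult_le_mono2)
    have "(2::nat) ^ ((m + 3) div 2) \<le> 2 ^ ((m + 4) div 2)"
      by (intro power_increasing div_le_mono) auto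
    moreover have "(2::nat) ^ ((m + 4) div 2) = 4 * 2 ^ (m div 2)"
    proof -
      have "(m + 4) div 2 = m div 2 + 2" by simp
      then show ?thesis by (simp only: power_add) simp
    qed
    moreover have "(\<Sum>i<m + 3. 2 ^ (i div 2)) + 2 = 2 ^ ((m + 3) div 2) + (2::nat) ^ ((m + 4) div 2)"
    proof -
      have "m + 3 + 1 = m + 4" by simp
      then show ?thesis using sum_power2_div2[of "m + 3"] by (simp only:)
    qed
    ultimately show "(\<Sum>i<m + 3. 2 ^ (i div 2)) \<le> 8 * (2::nat) ^ (m div 2)"
      by linarith
  qed
  finally show ?thesis by simp
qed

section \<open>One block: structured parts and a hitting set\<close>

text \<open>\<open>i\<close> is a dyadic exponent: all elements are at least
  \<open>2 ^ (i - 1)\<close>. The cut by \<open>r\<close> leaves of order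
  \<open>sqrt (2 ^ i) / Q powr (1/4)\<close> of them for the indices in use, where
  \<open>Q = 16 ^ r\<close>.\<close>

definition structured_part :: "nat \<Rightarrow> nat \<Rightarrow> nat set" where
  "structured_part r i = multiplier (i div 2) ` {..<2 ^ (i div 2 - r)}
     \<union> cofactor (16 ^ r) i ` {..<2 ^ (i div 2 - r)}"

text \<open>With \<open>Q = 16 ^ r\<close>, the index range contains the exponents
  \<open>2 * e\<close> and \<open>2 * e'\<close> of the multipliers and
  \<open>k - 3 - 2 * e'\<close> of the cofactor for all
  \<open>64 * Q \<le> k < 1024 * Q\<close>.\<close>

definition last_factors :: "nat \<Rightarrow> nat \<Rightarrow> nat set" where
  "last_factors r n = {b. \<exists>m m' d. {m, m', d} \<subseteq> (\<Union>i\<in>{2 * 16 ^ r..<1025 * 16 ^ r}. structured_part r i)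
     \<and> m * b + m' * d = n}"

text \<open>Hides the parameters of the explicit solutions in \<open>last_factors\<close> and writes
  the window for \<open>b\<close> as \<open>{2 ^ (i - 3)..<2 ^ i}\<close> with
  \<open>i = k + 1 - 2 * e\<close>, the form used for sampling.\<close>

lemma card_last_factors_ge:
  fixes r e k n :: nat
  defines "Q \<equiv> 16 ^ r"
  assumes r: "1 \<le> r" and e: "Q \<le> e" "e < 2 * Q" and k: "64 * Q \<le> k" "k < 1024 * Q"
    and n: "odd n" "2 ^ k \<le> n" "n < 2 ^ (k + 1)"
  shows "2 ^ ((k - 3) div 2 - e + r - 2) \<le>
    card ({2 ^ (k + 1 - 2 * e - 3)..<2 ^ (k + 1 - 2 * e)} \<inter> last_factors r n)"
proof -
  have mult: "multiplier e x \<in> (\<Union>i\<in>{2 * Q..<1025 * Q}. structured_part r i)"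
    if "Q \<le> e" "e < 6 * Q" "x < 2 ^ (e - r)" for e x
    using that unfolding structured_part_def by (intro UN_I[of "2 * e"]) auto
  have cof: "cofactor Q j t \<in> (\<Union>i\<in>{2 * Q..<1025 * Q}. structured_part r i)"
    if "2 * Q \<le> j" "j < 1025 * Q" "t < 2 ^ (j div 2 - r)" for j t
    using that unfolding structured_part_def Q_def by (intro UN_I[of j]) auto
  have "2 ^ ((k - 3) div 2 - e + r - 2) \<le> card {b \<in> {2 ^ (k - 2 - 2 * e)..<2 ^ (k + 1 - 2 * e)}.
      \<exists>x<2 ^ (e - r). \<exists>e'\<in>{5 * Q..<6 * Q}. \<exists>x'<2 ^ (e' - r). \<exists>t<2 ^ ((k - 3 - 2 * e') div 2 - r).
        multiplier e x * b + multiplier e' x' * cofactor Q (k - 3 - 2 * e') t = n}" (is "_ \<le> card ?C")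
    unfolding Q_def using r e k n by (intro card_last_factor_ge) (auto simp: Q_def)
  also have "?C \<subseteq> {2 ^ (k + 1 - 2 * e - 3)..<2 ^ (k + 1 - 2 * e)} \<inter> last_factors r n"
  proof
    fix b assume b: "b \<in> ?C"
    then obtain x e' x' t where *: "x < 2 ^ (e - r)" "e' \<in> {5 * Q..<6 * Q}" "x' < 2 ^ (e' - r)"
      "t < 2 ^ ((k - 3 - 2 * e') div 2 - r)"
      "multiplier e x * b + multiplier e' x' * cofactor Q (k - 3 - 2 * e') t = n"
      by blast
    have "k + 1 - 2 * e - 3 = k - 2 - 2 * e" by simp
    then have "b \<in> {2 ^ (k + 1 - 2 * e - 3)..<2 ^ (k + 1 - 2 * e)}" using b by simp
    moreover have "b \<in> last_factors r n"
    proof -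
      have "Q > 0" by (simp add: Q_def)
      then have "2 * Q \<le> k - 3 - 2 * e'" "k - 3 - 2 * e' < 1025 * Q" "e' < 6 * Q" "Q \<le> e'" "e < 6 * Q"
        using *(2) k e by auto
      then have "{multiplier e x, multiplier e' x', cofactor Q (k - 3 - 2 * e') t}
          \<subseteq> (\<Union>i\<in>{2 * 16 ^ r..<1025 * 16 ^ r}. structured_part r i)"
        using mult[OF e(1) _ *(1)] mult[OF _ _ *(3)] cof[OF _ _ *(4)] unfolding Q_def by simp
      then show ?thesis
        using *(5) unfolding last_factors_def by blast
    qed
    ultimately show "b \<in> {2 ^ (k + 1 - 2 * e - 3)..<2 ^ (k + 1 - 2 * e)} \<inter> last_factors r n" by blast
  qed
  then have "card ?C \<le> card ({2 ^ (k + 1 - 2 * e - 3)..<2 ^ (k + 1 - 2 * e)} \<inter> last_factors r n)"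
    by (intro card_mono) auto
  finally show ?thesis .
qed

text \<open>The sum is the expected number of hits when \<open>32768 * 2 ^ (i div 2 - r)\<close>
  elements are drawn from each window. If \<open>2 ^ k \<le> n < 2 ^ (k + 1)\<close>, each of the
  \<open>Q\<close> windows \<open>i = k + 1 - 2 * e\<close> with \<open>Q \<le> e < 2 * Q\<close>
  contributes at least 1024.\<close>

lemma sum_hitting_weights_ge:
  fixes r n :: nat
  defines "Q \<equiv> 16 ^ r"
  assumes r: "1 \<le> r" and n: "odd n" "2 ^ (64 * Q) \<le> n" "n < 2 ^ (1024 * Q)"
  shows "1024 * real Q \<le> (\<Sum>i\<in>{2 * Q..<1025 * Q}. real (32768 * 2 ^ (i div 2 - r)) *
    (real (card ({2 ^ (i - 3)..<2 ^ i} \<inter> last_factors r n)) / real (card {2 ^ (i - 3)..<(2::nat) ^ i})))"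
    (is "_ \<le> (\<Sum>i\<in>?I. ?w i)")
proof -
  have "r < 2 ^ r" "(2::nat) ^ r \<le> 16 ^ r" by (auto intro: power_mono)
  then have rQ: "r + 1 \<le> Q" unfolding Q_def by linarith
  obtain k where k: "2 ^ k \<le> n" "n < 2 ^ (k + 1)"
    using ex_power_ivl1[of 2 n] n by (auto simp: odd_pos Suc_leI)
  have "(2::nat) ^ (64 * Q) < 2 ^ (k + 1)" using n k by linarith
  then have "64 * Q < k + 1" by (rule power_less_imp_less_exp[rotated]) simp
  then have k1: "64 * Q \<le> k" by simp
  have "(2::nat) ^ k < 2 ^ (1024 * Q)" using n k by linarith
  then have k2: "k < 1024 * Q" by simp
  have w: "1024 \<le> ?w (k + 1 - 2 * e)" if e: "e \<in> {Q..<2 * Q}" for e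
  proof -
    define i where "i = k + 1 - 2 * e"
    define \<kappa> where "\<kappa> = (k - 3) div 2"
    have \<kappa>: "2 * \<kappa> \<le> k - 3" "k - 3 \<le> 2 * \<kappa> + 1" unfolding \<kappa>_def by auto
    have "2 ^ (\<kappa> - e + r - 2) \<le> card ({2 ^ (i - 3)..<2 ^ i} \<inter> last_factors r n)"
      unfolding \<kappa>_def i_def
      by (rule card_last_factors_ge) (use r e k k1 k2 n(1) in \<open>auto simp: Q_def\<close>)
    then have c: "2 ^ (\<kappa> - e + r - 2) \<le> real (card ({2 ^ (i - 3)..<2 ^ i} \<inter> last_factors r n))"
      by (metis of_nat_le_iff of_nat_numeral of_nat_power)
    have "(2::nat) ^ (i - 3) < 2 ^ i" using e k1 rQ by (intro power_strict_increasing) (auto simp: i_def)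
    then have u: "0 < card {2 ^ (i - 3)..<(2::nat) ^ i}" "real (card {2 ^ (i - 3)..<(2::nat) ^ i}) \<le> 2 ^ i"
      by (auto simp: of_nat_diff)
    have "(1024::real) * 2 ^ i \<le> 32768 * 2 ^ (i div 2 - r) * 2 ^ (\<kappa> - e + r - 2)"
    proof -
      have "(1024::real) * 2 ^ i = 2 ^ (10 + i)" by (simp add: power_add)
      \<comment> \<open>The last two exponents add up to at least \<open>i - 5\<close>;
        \<open>32768 = 2 ^ 15\<close> covers this loss and leaves \<open>2 ^ 10\<close>.\<close>
      also have "\<dots> \<le> 2 ^ (15 + (i div 2 - r) + (\<kappa> - e + r - 2))"
        using e k1 k2 rQ r \<kappa> by (intro power_increasing) (auto simp: i_def)
      also have "\<dots> = 32768 * 2 ^ (i div 2 - r) * 2 ^ (\<kappa> - e + r - 2)"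
        unfolding power_add by simp
      finally show ?thesis .
    qed
    also have "\<dots> \<le> 32768 * 2 ^ (i div 2 - r) * real (card ({2 ^ (i - 3)..<2 ^ i} \<inter> last_factors r n))"
      using c by (intro mult_left_mono) auto
    finally have "1024 \<le> 32768 * 2 ^ (i div 2 - r) * real (card ({2 ^ (i - 3)..<2 ^ i} \<inter> last_factors r n)) / 2 ^ i"
      by (simp add: pos_le_divide_eq)
    also have "\<dots> \<le> 32768 * 2 ^ (i div 2 - r) * real (card ({2 ^ (i - 3)..<2 ^ i} \<inter> last_factors r n))
        / real (card {2 ^ (i - 3)..<(2::nat) ^ i})"
      using u by (intro divide_left_mono mult_nonneg_nonneg mult_pos_pos) (simp_all del: card_atLeastLessThan)
    finally show ?thesis unfolding i_def by simp
  qed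
  have inj: "inj_on (\<lambda>e. k + 1 - 2 * e) {Q..<2 * Q}"
    using k1 by (auto simp: inj_on_def)
  have "1024 * real Q = (\<Sum>e\<in>{Q..<2 * Q}. 1024)" by simp
  also have "\<dots> \<le> (\<Sum>e\<in>{Q..<2 * Q}. ?w (k + 1 - 2 * e))"
    using w by (rule sum_mono)
  also have "\<dots> = (\<Sum>i\<in>(\<lambda>e. k + 1 - 2 * e) ` {Q..<2 * Q}. ?w i)"
    using sum.reindex[OF inj, of ?w] by (simp add: o_def)
  also have "\<dots> \<le> (\<Sum>i\<in>?I. ?w i)"
    using k1 k2 rQ by (intro sum_mono2) (auto intro!: divide_nonneg_nonneg)
  finally show ?thesis .
qed

text \<open>The elements of \<open>structured_part\<close> serve as the two multipliers and the cofactor of every \<open>n\<close>;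
  the remaining factors are a hitting set, found by counting, for the sets \<open>last_factors\<close>.\<close>
lemma exists_block:
  fixes r :: nat
  defines "Q \<equiv> 16 ^ r"
  assumes r: "1 \<le> r"
  shows "\<exists>S. finite S \<and> (\<forall>a\<in>S. 2 ^ Q \<le> a)
    \<and> (\<forall>n. odd n \<and> 2 ^ (64 * Q) \<le> n \<and> n < 2 ^ (1024 * Q) \<longrightarrow> n \<in> sum_set (prod_set S))
    \<and> 2 ^ r * card S \<le> 262160 * 2 ^ (513 * Q)
    \<and> (\<forall>l. 2 ^ r * card (S \<inter> {..<2 ^ l}) \<le> 262160 * 2 ^ (l div 2))"
proof -
  have "r < 2 ^ r" "(2::nat) ^ r \<le> 16 ^ r" by (auto intro: power_mono)
  then have rQ: "r + 1 \<le> Q" unfolding Q_def by linarith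
  have "(16::nat) ^ 1 \<le> 16 ^ r" using r by (intro power_increasing) auto
  then have Q16: "16 \<le> Q" by (simp add: Q_def)
  define I where "I = {2 * Q..<1025 * Q}"
  define q where "q i = 32768 * (2::nat) ^ (i div 2 - r)" for i
  \<comment> \<open>The coordinate \<open>(i, j)\<close> is the \<open>j\<close>-th draw from the
    window of index \<open>i\<close>.\<close>
  define T where "T = Sigma I (\<lambda>i. {..<q i})"
  define U where "U = (\<lambda>(i, j::nat). {2 ^ (i - 3)..<(2::nat) ^ i})"
  define N where "N = {n. odd n \<and> 2 ^ (64 * Q) \<le> n \<and> n < (2::nat) ^ (1024 * Q)}"
  have finN: "finite N" unfolding N_def by auto
  have I16: "16 \<le> i" if "i \<in> I" for i using that Q16 by (auto simp: I_def)
  have Une: "U s \<noteq> {}" if sT: "s \<in> T" for s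
  proof -
    obtain i j where s: "s = (i, j)" "i \<in> I" using sT by (auto simp: T_def)
    then have "i - 3 < i" using I16[of i] by simp
    then have "(2::nat) ^ (i - 3) < 2 ^ i" by (intro power_strict_increasing) auto
    then show ?thesis by (auto simp: U_def s)
  qed
  have prod: "(\<Prod>s\<in>T. 1 - real (card (U s \<inter> last_factors r n)) / real (card (U s))) \<le> exp (- (1024 * real Q))"
    if "n \<in> N" for n
  proof -
    let ?\<rho> = "\<lambda>s. real (card (U s \<inter> last_factors r n)) / real (card (U s))"
    \<comment> \<open>Turns the probability of missing \<open>n\<close> into the exponential of
      minus the expected number of hits.\<close>
    have "(\<Prod>s\<in>T. 1 - ?\<rho> s) \<le> (\<Prod>s\<in>T. exp (- ?\<rho> s))"
    proof (rule prod_mono, intro conjI)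
      fix s assume s: "s \<in> T"
      have "finite (U s)" by (cases s) (auto simp: U_def)
      then have "card (U s \<inter> last_factors r n) \<le> card (U s)" by (intro card_mono) auto
      then show "0 \<le> 1 - ?\<rho> s" by (auto simp: divide_le_eq_1)
      show "1 - ?\<rho> s \<le> exp (- ?\<rho> s)" using exp_ge_add_one_self[of "- ?\<rho> s"] by simp
    qed
    also have "\<dots> = exp (- (\<Sum>s\<in>T. ?\<rho> s))"
      by (simp add: exp_sum T_def I_def sum_negf[symmetric])
    also have "(\<Sum>s\<in>T. ?\<rho> s) = (\<Sum>i\<in>I. real (q i) * ?\<rho> (i, 0))"
    proof -
      have "(\<Sum>s\<in>T. ?\<rho> s) = (\<Sum>i\<in>I. \<Sum>j<q i. ?\<rho> (i, j))"
        unfolding T_def by (subst sum.Sigma) (auto simp: I_def)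
      also have "\<dots> = (\<Sum>i\<in>I. real (q i) * ?\<rho> (i, 0))"
        by (simp add: U_def)
      finally show ?thesis .
    qed
    also have "exp (- \<dots>) \<le> exp (- (1024 * real Q))"
      using sum_hitting_weights_ge[of r n] r that by (simp add: N_def U_def I_def q_def Q_def)
    finally show ?thesis .
  qed
  have "(\<Sum>n\<in>N. \<Prod>s\<in>T. 1 - real (card (U s \<inter> last_factors r n)) / real (card (U s)))
      \<le> (\<Sum>n\<in>N. exp (- (1024 * real Q)))"
    using prod by (rule sum_mono)
  also have "\<dots> = real (card N) * exp (- (1024 * real Q))" by simp
  \<comment> \<open>There are fewer than \<open>2 ^ (1024 * Q)\<close> targets, and
    \<open>2 \<le> exp 1\<close>: this is why the expected number of hits was made
    \<open>1024 * Q\<close>.\<close>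
  also have "\<dots> < 2 ^ (1024 * Q) * exp (- (1024 * real Q))"
  proof (rule mult_strict_right_mono)
    have "N \<subseteq> {1..<2 ^ (1024 * Q)}" unfolding N_def using odd_pos by (auto simp: Suc_le_eq)
    then have "card N \<le> card {1..<(2::nat) ^ (1024 * Q)}" by (intro card_mono) auto
    then have "card N \<le> 2 ^ (1024 * Q) - 1" by simp
    moreover have "0 < (2::nat) ^ (1024 * Q)" by simp
    ultimately have "card N < 2 ^ (1024 * Q)" by linarith
    then show "real (card N) < 2 ^ (1024 * Q)" by (metis of_nat_less_iff of_nat_numeral of_nat_power)
  qed simp
  also have "\<dots> \<le> exp 1 ^ (1024 * Q) * exp (- (1024 * real Q))"
    using exp_ge_add_one_self[of 1] by (intro mult_right_mono power_mono) auto
  also have "\<dots> = 1"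
    by (simp add: exp_of_nat_mult[symmetric] exp_add[symmetric])
  finally have small: "(\<Sum>n\<in>N. \<Prod>s\<in>T. 1 - real (card (U s \<inter> last_factors r n)) / real (card (U s))) < 1" .
  have finT: "finite T" by (auto simp: T_def I_def)
  have finU: "finite (U s)" for s by (cases s) (auto simp: U_def)
  obtain f where f: "f \<in> PiE T U" "\<And>n. n \<in> N \<Longrightarrow> \<exists>s\<in>T. f s \<in> last_factors r n"
    using exists_hitting_choice[OF finT finN finU Une small] by blast
  define S where "S i = structured_part r i \<union> (\<lambda>j. f (i, j)) ` {..<q i}" for i
  have finS: "finite (S i)" for i by (simp add: S_def structured_part_def)
  \<comment> \<open>\<open>32770 = 32768 + 2\<close>: the draws, the multipliers and the
    cofactors.\<close>
  have cardS: "2 ^ r * card (S i) \<le> 32770 * 2 ^ (i div 2)" if "i \<in> I" for i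
  proof -
    have "card (structured_part r i) \<le> 2 ^ (i div 2 - r) + 2 ^ (i div 2 - r)"
      unfolding structured_part_def
      by (intro order.trans[OF card_Un_le] add_mono order.trans[OF card_image_le]) auto
    moreover have "card ((\<lambda>j. f (i, j)) ` {..<q i}) \<le> q i"
      by (rule order.trans[OF card_image_le]) auto
    ultimately have "card (S i) \<le> 32770 * 2 ^ (i div 2 - r)"
      unfolding S_def using card_Un_le[of "structured_part r i" "(\<lambda>j. f (i, j)) ` {..<q i}"]
      by (simp add: q_def)
    then have "2 ^ r * card (S i) \<le> 2 ^ r * (32770 * 2 ^ (i div 2 - r))" by (rule mult_le_mono2)
    also have "\<dots> = 32770 * 2 ^ (r + (i div 2 - r))" by (simp add: power_add)
    also have "r + (i div 2 - r) = i div 2" using that rQ by (auto simp: I_def)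
    finally show ?thesis .
  qed
  \<comment> \<open>The weakest bound comes from the drawn elements, whose window starts at
    \<open>2 ^ (i - 3)\<close>.\<close>
  have large: "2 ^ (i - 3) \<le> a" if "i \<in> I" "a \<in> S i" for i a
  proof -
    have "(2::nat) ^ (i - 3) \<le> 2 ^ (2 * (i div 2))" "(2::nat) ^ (i - 3) \<le> 2 ^ i"
      by (intro power_increasing; linarith)+
    then have "2 ^ (i - 3) \<le> multiplier (i div 2) x" "2 ^ (i - 3) \<le> cofactor (16 ^ r) i x" for x
      unfolding multiplier_def cofactor_def by linarith+
    moreover have "2 ^ (i - 3) \<le> f (i, j)" if "j < q i" for j
      using PiE_mem[OF f(1), of "(i, j)"] that \<open>i \<in> I\<close> by (auto simp: T_def U_def)
    ultimately show ?thesis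
      using that by (auto simp: S_def structured_part_def)
  qed
  define B where "B = (\<Union>i\<in>I. S i)"
  have "finite B" using finS by (auto simp: B_def I_def)
  moreover have "2 ^ Q \<le> a" if aB: "a \<in> B" for a
  proof -
    from aB obtain i where i: "i \<in> I" "a \<in> S i" by (auto simp: B_def)
    have "(2::nat) ^ Q \<le> 2 ^ (i - 3)" using i(1) Q16 by (intro power_increasing) (auto simp: I_def)
    then show ?thesis using large[OF i] by linarith
  qed
  moreover have "n \<in> sum_set (prod_set B)" if n: "odd n" "2 ^ (64 * Q) \<le> n" "n < 2 ^ (1024 * Q)" for n
  proof -
    obtain i j where ij: "i \<in> I" "j < q i" "f (i, j) \<in> last_factors r n"
      using f(2)[of n] n by (auto simp: N_def T_def)
    have "f (i, j) \<in> B" using ij by (auto simp: B_def S_def)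
    moreover obtain m m' d where "{m, m', d} \<subseteq> (\<Union>i\<in>I. structured_part r i)" and eq: "m * f (i, j) + m' * d = n"
      using ij(3) unfolding last_factors_def I_def Q_def by blast
    then have "m \<in> B" "m' \<in> B" "d \<in> B" by (auto simp: B_def S_def)
    ultimately show ?thesis
      using eq unfolding sum_set_def prod_set_def by blast
  qed
  \<comment> \<open>\<open>262160 = 8 * 32770\<close>, and \<open>513 * Q\<close> is at least half
    of \<open>1025 * Q\<close>.\<close>
  moreover have "2 ^ r * card B \<le> 262160 * 2 ^ (513 * Q)"
  proof -
    have "2 ^ r * card B \<le> 8 * 32770 * 2 ^ ((1025 * Q) div 2)"
      unfolding B_def using cardS by (intro card_UN_power2_le) (auto simp: I_def)
    also have "\<dots> \<le> 8 * 32770 * 2 ^ (513 * Q)"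
      by (intro mult_le_mono2 power_increasing) auto
    finally show ?thesis by simp
  qed
  moreover have "2 ^ r * card (B \<inter> {..<2 ^ l}) \<le> 262160 * 2 ^ (l div 2)" for l
  proof -
    have "B \<inter> {..<2 ^ l} \<subseteq> (\<Union>i\<in>I \<inter> {..<l + 3}. S i)"
    proof
      fix a assume "a \<in> B \<inter> {..<2 ^ l}"
      then obtain i where i: "i \<in> I" "a \<in> S i" "a < 2 ^ l" by (auto simp: B_def)
      have "(2::nat) ^ (i - 3) < 2 ^ l" by (rule le_less_trans[OF large[OF i(1,2)] i(3)])
      then have "i - 3 < l" by simp
      then show "a \<in> (\<Union>i\<in>I \<inter> {..<l + 3}. S i)" using i by auto
    qed
    then have "card (B \<inter> {..<2 ^ l}) \<le> card (\<Union>i\<in>I \<inter> {..<l + 3}. S i)"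
      using finS by (intro card_mono) auto
    then have "2 ^ r * card (B \<inter> {..<2 ^ l}) \<le> 2 ^ r * card (\<Union>i\<in>I \<inter> {..<l + 3}. S i)" by simp
    also have "\<dots> \<le> 8 * 32770 * 2 ^ (l div 2)"
      using cardS by (intro card_UN_power2_le) auto
    finally show ?thesis by simp
  qed
  ultimately show ?thesis by blast
qed

section \<open>Counting the union of the blocks closed under doubling\<close>

text \<open>A geometric tail from the first \<open>r0\<close> with \<open>y < 2 ^ r0\<close>, hence
  at most \<open>2 / 2 ^ r0\<close>.\<close>

lemma sum_inverse_power2_le:
  fixes y :: real
  assumes "y > 0"
  shows "(\<Sum>r | r < n \<and> y < 2 ^ r. 1 / 2 ^ r) \<le> 2 / y"
proof -
  define r0 where "r0 = (LEAST r. y < 2 ^ r)"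
  have "\<exists>r. y < 2 ^ r" by (rule real_arch_pow) simp
  then have r0: "y < 2 ^ r0" "\<And>r. y < 2 ^ r \<Longrightarrow> r0 \<le> r"
    unfolding r0_def by (rule LeastI_ex) (rule Least_le)
  have tail: "(\<Sum>r\<in>{r0..<r0 + k}. 1 / 2 ^ r) = (2 - 2 / 2 ^ k) / (2::real) ^ r0" for k
  proof (induction k)
    case (Suc k)
    have "(\<Sum>r\<in>{r0..<r0 + Suc k}. 1 / 2 ^ r) = (2 - 2 / 2 ^ k) / (2::real) ^ r0 + 1 / 2 ^ (r0 + k)"
      by (simp flip: Suc)
    also have "\<dots> = (2 - 2 / 2 ^ Suc k) / 2 ^ r0" by (simp add: power_add field_simps)
    finally show ?case .
  qed simp
  have "(\<Sum>r | r < n \<and> y < 2 ^ r. 1 / (2::real) ^ r) \<le> (\<Sum>r\<in>{r0..<r0 + n}. 1 / 2 ^ r)"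
    using r0(2) by (intro sum_mono2) auto
  also have "\<dots> = (2 - 2 / 2 ^ n) / 2 ^ r0" by (rule tail)
  also have "\<dots> \<le> 2 / 2 ^ r0" by (intro divide_right_mono) auto
  also have "\<dots> \<le> 2 / y" using r0(1) assms by (intro divide_left_mono) auto
  finally show ?thesis .
qed

lemma exists_odd_part:
  fixes n :: nat
  assumes "n > 0"
  shows "\<exists>v m. n = 2 ^ v * m \<and> odd m"
  using assms
proof (induction n rule: less_induct)
  case (less n)
  show ?case
  proof (cases "odd n")
    case True
    then show ?thesis by (intro exI[of _ 0] exI[of _ n]) simp
  next
    case False
    then obtain k where k: "n = 2 * k" by blast
    then have "k < n" "k > 0" using less.prems by auto
    then obtain v m where "k = 2 ^ v * m" "odd m" using less.IH by blast
    then show ?thesis using k by (intro exI[of _ "Suc v"] exI[of _ m]) simp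
  qed
qed

text \<open>The main term comes from the blocks with \<open>2 ^ r > y\<close>, for \<open>y\<close>
  of order \<open>l powr (1/4)\<close>: their savings \<open>1 / 2 ^ r\<close> sum to order
  \<open>1 / y\<close>. Each earlier block has at most \<open>C * 2 powr (l / 4)\<close> elements in
  total. Doubling costs the main term only a constant factor, as its counts decay geometrically in
  \<open>w\<close>.\<close>

lemma card_doubling_closure_le:
  fixes S :: "nat \<Rightarrow> nat set" and A :: "nat set" and N C :: nat
  assumes A: "A = {2 ^ w * a | w a. a \<le> N \<or> (\<exists>r\<ge>1. a \<in> S r)}"
    and fin: "\<And>r. 1 \<le> r \<Longrightarrow> finite (S r)"
    and large: "\<And>r a. 1 \<le> r \<Longrightarrow> a \<in> S r \<Longrightarrow> 2 ^ 16 ^ r \<le> a"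
    and total: "\<And>r. 1 \<le> r \<Longrightarrow> 2 ^ r * card (S r) \<le> C * 2 ^ (513 * 16 ^ r)"
    and initial: "\<And>r l. 1 \<le> r \<Longrightarrow> 2 ^ r * card (S r \<inter> {..<2 ^ l}) \<le> C * 2 ^ (l div 2)"
    and l: "1 \<le> l"
  shows "real (card (A \<inter> {1..<2 ^ l})) \<le> (N + 1) * l + C * l ^ 2 * 2 powr (l / 4)
    + 112 * C * (2 powr (l / 2) / l powr (1/4))"
proof -
  \<comment> \<open>Base elements that stay below \<open>2 ^ l\<close> after \<open>w\<close>
    doublings; \<open>r < l\<close> suffices because \<open>S r\<close> starts at
    \<open>2 ^ 16 ^ r\<close>.\<close>
  define D where "D w = {..N} \<union> (\<Union>r\<in>{1..<l}. S r \<inter> {..<2 ^ (l - w)})" for w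
  \<comment> \<open>\<open>2052 = 4 * 513\<close>, so \<open>2 ^ r \<le> y\<close> means
    \<open>513 * 16 ^ r \<le> l / 4\<close>, which makes the total size of the block small.\<close>
  define y where "y = (real l / 2052) powr (1/4)"
  have y: "y > 0" using l by (simp add: y_def)
  have finD: "finite (D w)" for w using fin by (auto simp: D_def)
  have sub: "A \<inter> {1..<2 ^ l} \<subseteq> (\<Union>w\<in>{..<l}. (*) (2 ^ w) ` D w)"
  proof
    fix n assume n: "n \<in> A \<inter> {1..<2 ^ l}"
    then obtain w a where "n = 2 ^ w * a" "a \<le> N \<or> (\<exists>r\<ge>1. a \<in> S r)"
      unfolding A by blast
    with n have wa: "n = 2 ^ w * a" "a \<le> N \<or> (\<exists>r\<ge>1. a \<in> S r)" "1 \<le> n" "n < 2 ^ l"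
      by auto
    have "2 ^ w * 1 \<le> 2 ^ w * a" using wa by (intro mult_le_mono2) (auto simp: Suc_le_eq)
    then have "(2::nat) ^ w < 2 ^ l" using wa by linarith
    then have w: "w < l" by simp
    have "2 ^ w * a < 2 ^ w * 2 ^ (l - w)" using wa w by (simp flip: power_add)
    then have a: "a < 2 ^ (l - w)" by simp
    have "a \<in> D w"
    proof (cases "a \<le> N")
      case False
      then obtain r where r: "1 \<le> r" "a \<in> S r" using wa by blast
      have "(2::nat) ^ 16 ^ r < 2 ^ (l - w)" using large[OF r] a by linarith
      then have "16 ^ r < l - w" by simp
      moreover have "r < 2 ^ r" "(2::nat) ^ r \<le> 16 ^ r" by (auto intro: power_mono)
      ultimately have "r < l" by linarith
      then show ?thesis using r a by (auto simp: D_def)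
    qed (simp add: D_def)
    then show "n \<in> (\<Union>w\<in>{..<l}. (*) (2 ^ w) ` D w)" using wa(1) w by blast
  qed
  let ?R = "{r. r < l \<and> y < 2 ^ r}"
  have card_initial: "real (card (S r \<inter> {..<2 ^ m})) \<le> C * 2 powr (l / 4)
      + (if y < 2 ^ r then C * (2 ^ (m div 2) * (1 / 2 ^ r)) else 0)" if r: "1 \<le> r" for r m
  proof (cases "y < 2 ^ r")
    case True
    have "real (2 ^ r * card (S r \<inter> {..<2 ^ m})) \<le> real (C * 2 ^ (m div 2))"
      using initial[OF r] of_nat_le_iff by blast
    then have "real (card (S r \<inter> {..<2 ^ m})) \<le> C * (2 ^ (m div 2) * (1 / 2 ^ r))"
      by (simp add: field_simps)
    moreover have "0 \<le> C * 2 powr (l / 4)" by simp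
    ultimately show ?thesis unfolding if_P[OF True] by linarith
  next
    case False
    have "((2::real) ^ r) powr 4 \<le> y powr 4" using False by (intro powr_mono2) auto
    also have "y powr 4 = real l / 2052" by (simp add: y_def powr_powr)
    also have "((2::real) ^ r) powr 4 = (2 ^ r) ^ 4" by simp
    also have "\<dots> = (2 ^ 4) ^ r" by (simp only: power_mult[symmetric] mult.commute)
    also have "\<dots> = 16 ^ r" by simp
    finally have small: "513 * 16 ^ r \<le> real l / 4" by simp
    have "card (S r \<inter> {..<2 ^ m}) \<le> card (S r)" using fin[OF r] by (intro card_mono) auto
    also have "\<dots> \<le> 2 ^ r * card (S r)" by simp
    also have "\<dots> \<le> C * 2 ^ (513 * 16 ^ r)" by (rule total[OF r])
    finally have "real (card (S r \<inter> {..<2 ^ m})) \<le> real (C * 2 ^ (513 * 16 ^ r))"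
      using of_nat_le_iff by blast
    also have "\<dots> = C * 2 powr (real (513 * 16 ^ r))" by (simp add: powr_realpow[symmetric])
    also have "\<dots> \<le> C * 2 powr (l / 4)" using small by (intro mult_left_mono powr_mono) auto
    finally show ?thesis using False by simp
  qed
  have cardD: "real (card (D w)) \<le> (N + 1) + C * l * 2 powr (l / 4) + 2 * C / y * 2 ^ ((l - w) div 2)" for w
  proof -
    have "card (D w) \<le> (N + 1) + (\<Sum>r\<in>{1..<l}. card (S r \<inter> {..<2 ^ (l - w)}))"
      unfolding D_def
      by (rule order.trans[OF card_Un_le], rule add_mono[OF _ card_UN_le]) auto
    then have "real (card (D w)) \<le> (N + 1) + (\<Sum>r\<in>{1..<l}. real (card (S r \<inter> {..<2 ^ (l - w)})))"
      by (metis of_nat_add of_nat_le_iff of_nat_sum)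
    also have "(\<Sum>r\<in>{1..<l}. real (card (S r \<inter> {..<2 ^ (l - w)})))
        \<le> (\<Sum>r\<in>{1..<l}. C * 2 powr (l / 4)
          + (if y < 2 ^ r then C * (2 ^ ((l - w) div 2) * (1 / 2 ^ r)) else 0))"
      by (rule sum_mono, rule card_initial) auto
    also have "\<dots> \<le> (\<Sum>r<l. C * 2 powr (l / 4)
          + (if y < 2 ^ r then C * (2 ^ ((l - w) div 2) * (1 / 2 ^ r)) else 0))"
      by (intro sum_mono2) auto
    also have "\<dots> = l * (C * 2 powr (l / 4)) + (\<Sum>r\<in>?R. C * (2 ^ ((l - w) div 2) * (1 / 2 ^ r)))"
      by (simp add: sum.distrib sum.If_cases Int_def lessThan_def)
    also have "(\<Sum>r\<in>?R. C * (2 ^ ((l - w) div 2) * (1 / 2 ^ r)))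
        = C * 2 ^ ((l - w) div 2) * (\<Sum>r\<in>?R. 1 / (2::real) ^ r)"
      by (simp add: sum_distrib_left mult.assoc)
    also have "\<dots> \<le> C * 2 ^ ((l - w) div 2) * (2 / y)"
      using sum_inverse_power2_le[OF y, of l] by (intro mult_left_mono) auto
    finally show ?thesis by (simp add: algebra_simps)
  qed
  have pow: "(\<Sum>w<l. (2::real) ^ ((l - w) div 2)) \<le> 8 * 2 powr (l / 2)"
  proof -
    have "(\<Sum>w<l. (2::nat) ^ ((l - w) div 2)) \<le> (\<Sum>i<l + 1. 2 ^ (i div 2))"
    proof -
      have "(\<Sum>w<l. (2::nat) ^ ((l - w) div 2)) = (\<Sum>i\<in>(\<lambda>w. l - w) ` {..<l}. 2 ^ (i div 2))"
        by (subst sum.reindex) (auto simp: inj_on_def)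
      also have "\<dots> \<le> (\<Sum>i<l + 1. 2 ^ (i div 2))" by (intro sum_mono2) auto
      finally show ?thesis .
    qed
    also have "\<dots> \<le> 2 ^ ((l + 1) div 2) + 2 ^ ((l + 1 + 1) div 2)"
      using sum_power2_div2[of "l + 1"] by linarith
    also have "\<dots> \<le> 2 ^ (l div 2 + 1) + 2 ^ (l div 2 + 1)"
      by (intro add_mono power_increasing) auto
    also have "\<dots> \<le> 4 * 2 ^ (l div 2)" by simp
    finally have "real (\<Sum>w<l. (2::nat) ^ ((l - w) div 2)) \<le> real (4 * 2 ^ (l div 2))"
      using of_nat_le_iff by blast
    also have "\<dots> = 4 * 2 powr (real (l div 2))" by (simp add: powr_realpow)
    also have "\<dots> \<le> 4 * 2 powr (l / 2)" by (intro mult_left_mono powr_mono) linarith+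
    also have "\<dots> \<le> 8 * 2 powr (l / 2)" by simp
    finally show ?thesis by simp
  qed
  \<comment> \<open>\<open>7 ^ 4 = 2401\<close> exceeds 2052. The final constant is
    \<open>112 = 2 * 7 * 8\<close>, with 2 from the tail over \<open>r\<close> and 8 from the sum
    over \<open>w\<close>.\<close>
  have "(2052::real) powr (1/4) \<le> (7 powr 4) powr (1/4)" by (intro powr_mono2) auto
  also have "\<dots> = 7" by (simp only: powr_powr) simp
  finally have y_inv: "1 / y \<le> 7 / l powr (1/4)"
    using l by (simp add: y_def powr_divide divide_right_mono)
  have "card (A \<inter> {1..<2 ^ l}) \<le> (\<Sum>w<l. card ((*) (2 ^ w) ` D w))"
    using finD by (intro order.trans[OF card_mono[OF _ sub] card_UN_le]) auto
  also have "\<dots> \<le> (\<Sum>w<l. card (D w))"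
    using finD by (intro sum_mono card_image_le)
  finally have "real (card (A \<inter> {1..<2 ^ l})) \<le> (\<Sum>w<l. real (card (D w)))"
    by (metis of_nat_le_iff of_nat_sum)
  also have "\<dots> \<le> (\<Sum>w<l. (N + 1) + C * l * 2 powr (l / 4) + 2 * C / y * 2 ^ ((l - w) div 2))"
    by (rule sum_mono) (rule cardD)
  also have "\<dots> = (N + 1) * l + C * l ^ 2 * 2 powr (l / 4) + 2 * C * (1 / y) * (\<Sum>w<l. 2 ^ ((l - w) div 2))"
    by (simp add: sum.distrib sum_distrib_left power2_eq_square algebra_simps)
  also have "\<dots> \<le> (N + 1) * l + C * l ^ 2 * 2 powr (l / 4) + 2 * C * (7 / l powr (1/4)) * (8 * 2 powr (l / 2))"
  proof (rule add_left_mono, rule mult_mono[OF _ pow])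
    show "2 * C * (1 / y) \<le> 2 * C * (7 / l powr (1/4))"
      using y_inv by (intro mult_left_mono) auto
  qed (simp_all add: sum_nonneg)
  finally show ?thesis by (simp add: algebra_simps)
qed

section \<open>From dyadic bounds to the asymptotic estimate\<close>

text \<open>For the \<open>l\<close> with \<open>X < 2 ^ l \<le> 2 * X\<close> one has
  \<open>ln X \<le> l \<le> 2 * ln X + 1\<close>, so the bound translates to \<open>X\<close>; its
  first two terms are of lower order than the third.\<close>

lemma count_fun_bigo:
  fixes A :: "nat set" and c1 c2 c3 :: real
  assumes bound: "\<And>l. 1 \<le> l \<Longrightarrow> real (card (A \<inter> {1..<2 ^ l}))
      \<le> c1 * l + c2 * l ^ 2 * 2 powr (l / 4) + c3 * (2 powr (l / 2) / l powr (1/4))"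
    and nonneg: "0 \<le> c1" "0 \<le> c2" "0 \<le> c3"
  shows "(\<lambda>X. real (count_fun A X)) \<in> O[at_top](\<lambda>X. sqrt X / (ln X) powr (1/4))"
proof -
  define G where "G X = c1 * (2 * ln X + 1) + c2 * ((2 * ln X + 1) ^ 2 * (2 * X) powr (1/4))
    + c3 * ((2 * X) powr (1/2) / ln X powr (1/4))" for X :: real
  have le: "real (count_fun A X) \<le> G X" if X: "X \<ge> 2" for X
  proof -
    define l where "l = nat \<lfloor>log 2 X\<rfloor> + 1"
    have "1 \<le> log 2 X" using X by simp
    then have "real l = of_int \<lfloor>log 2 X\<rfloor> + 1" by (simp add: l_def)
    then have l1: "log 2 X < l" and l2: "real l \<le> log 2 X + 1" by linarith+
    have ln2: "1/2 \<le> ln (2::real)"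
      using exp_half_le2 by (subst ln_ge_iff) simp_all
    have lnX: "ln X > 0" using X by simp
    have "ln X \<le> log 2 X" "log 2 X \<le> 2 * ln X"
      using ln2 ln_2_less_1 lnX by (simp_all add: log_def field_simps)
    with l1 l2 have l: "ln X \<le> l" "real l \<le> 2 * ln X + 1" by linarith+
    have X2: "X < 2 powr l" using l1 X by (simp add: log_less_iff)
    have "2 powr real l \<le> 2 powr (log 2 X + 1)" using l2 by simp
    also have "\<dots> = 2 * X" using X by (simp add: powr_add)
    finally have two: "2 powr real l \<le> 2 * X" .
    have four: "2 powr (l / 4) \<le> (2 * X) powr (1/4)" "2 powr (l / 2) \<le> (2 * X) powr (1/2)"
      using powr_mono2[OF _ _ two, of "1/4"] powr_mono2[OF _ _ two, of "1/2"] by (auto simp: powr_powr)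
    have "{n \<in> A. 1 \<le> real n \<and> real n \<le> X} \<subseteq> A \<inter> {1..<2 ^ l}"
    proof
      fix n assume "n \<in> {n \<in> A. 1 \<le> real n \<and> real n \<le> X}"
      then have "n \<in> A" "1 \<le> real n" "real n \<le> X" by auto
      then have "real n < 2 powr l" using X2 by linarith
      also have "\<dots> = real (2 ^ l)" by (simp add: powr_realpow)
      finally have "n < 2 ^ l" by (simp only: of_nat_less_iff)
      then show "n \<in> A \<inter> {1..<2 ^ l}" using \<open>n \<in> A\<close> \<open>1 \<le> real n\<close> by simp
    qed
    then have "count_fun A X \<le> card (A \<inter> {1..<2 ^ l})"
      unfolding count_fun_def by (intro card_mono) auto
    then have "real (count_fun A X) \<le> c1 * l + c2 * l ^ 2 * 2 powr (l / 4) + c3 * (2 powr (l / 2) / l powr (1/4))"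
      using bound[of l] by (simp add: l_def)
    also have "\<dots> \<le> c1 * (2 * ln X + 1) + c2 * (2 * ln X + 1) ^ 2 * (2 * X) powr (1/4)
        + c3 * ((2 * X) powr (1/2) / ln X powr (1/4))"
      using l four nonneg lnX by (intro add_mono mult_mono frac_le powr_mono2 power_mono) auto
    finally show ?thesis by (simp add: G_def mult.assoc)
  qed
  have scale: "(\<lambda>X. c * f X) \<in> O(g)" if "f \<in> O(g)" for c and f g :: "real \<Rightarrow> real"
    using that by (cases "c = 0") auto
  have asymp: "(\<lambda>X::real. 2 * ln X + 1) \<in> O(\<lambda>X. sqrt X / (ln X) powr (1/4))"
    "(\<lambda>X::real. (2 * ln X + 1) ^ 2 * (2 * X) powr (1/4)) \<in> O(\<lambda>X. sqrt X / (ln X) powr (1/4))"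
    "(\<lambda>X::real. (2 * X) powr (1/2) / ln X powr (1/4)) \<in> O(\<lambda>X. sqrt X / (ln X) powr (1/4))"
    by real_asymp+
  have "G \<in> O(\<lambda>X. sqrt X / (ln X) powr (1/4))"
    unfolding G_def by (rule sum_in_bigo(1)[OF sum_in_bigo(1)] scale asymp)+
  moreover have "(\<lambda>X. real (count_fun A X)) \<in> O(G)"
  proof (intro bigoI[of _ 1] eventually_mono[OF eventually_ge_at_top[of 2]])
    fix X :: real assume "2 \<le> X"
    then show "norm (real (count_fun A X)) \<le> 1 * norm (G X)" using le[of X] by simp
  qed
  ultimately show ?thesis by (rule landau_o.big_trans[rotated])
qed

section \<open>Assembling the blocks and treating even numbers\<close>

theorem theorem1p4:
  shows "\<exists>A :: nat set. sum_set (prod_set A) = UNIV \<and>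
    (\<lambda>X. real (count_fun A X)) \<in> O[at_top](\<lambda>X. sqrt X / (ln X) powr (1/4))"
proof -
  define P where "P r S \<longleftrightarrow> finite S \<and> (\<forall>a\<in>S. 2 ^ 16 ^ r \<le> a)
    \<and> (\<forall>n. odd n \<and> 2 ^ (64 * 16 ^ r) \<le> n \<and> n < 2 ^ (1024 * 16 ^ r) \<longrightarrow> n \<in> sum_set (prod_set S))
    \<and> 2 ^ r * card S \<le> 262160 * 2 ^ (513 * 16 ^ r)
    \<and> (\<forall>l. 2 ^ r * card (S \<inter> {..<2 ^ l}) \<le> 262160 * 2 ^ (l div 2))" for r S
  define S where "S r = (SOME S. P r S)" for r
  have PS: "P r (S r)" if "1 \<le> r" for r
    unfolding S_def using exists_block[OF that] by (intro someI_ex[of "P r"]) (simp only: P_def)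
  have S: "\<And>r. 1 \<le> r \<Longrightarrow> finite (S r)" "\<And>r a. 1 \<le> r \<Longrightarrow> a \<in> S r \<Longrightarrow> 2 ^ 16 ^ r \<le> a"
    "\<And>r n. 1 \<le> r \<Longrightarrow> odd n \<Longrightarrow> 2 ^ (64 * 16 ^ r) \<le> n \<Longrightarrow> n < 2 ^ (1024 * 16 ^ r)
      \<Longrightarrow> n \<in> sum_set (prod_set (S r))"
    "\<And>r. 1 \<le> r \<Longrightarrow> 2 ^ r * card (S r) \<le> 262160 * 2 ^ (513 * 16 ^ r)"
    "\<And>r l. 1 \<le> r \<Longrightarrow> 2 ^ r * card (S r \<inter> {..<2 ^ l}) \<le> 262160 * 2 ^ (l div 2)"
    using PS unfolding P_def by blast+
  \<comment> \<open>The block \<open>r = 1\<close> starts at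
    \<open>2 ^ (64 * 16) = 2 ^ 1024\<close>; everything up to there is put into
    \<open>A\<close>.\<close>
  define N :: nat where "N = 2 ^ 1024"
  define A where "A = {2 ^ w * a | w a. a \<le> N \<or> (\<exists>r\<ge>1. a \<in> S r)}"
  have small: "2 ^ w * a \<in> A" if "a \<le> N" for w a
    using that by (auto simp: A_def)
  have block: "2 ^ w * a \<in> A" if "1 \<le> r" "a \<in> S r" for w a r
    using that by (auto simp: A_def)
  have sumI: "a * b + c * d \<in> sum_set (prod_set A)" if "a \<in> A" "b \<in> A" "c \<in> A" "d \<in> A" for a b c d
    using that unfolding sum_set_def prod_set_def by blast
  have "N \<ge> 1" by (simp add: N_def)
  have "0 \<in> A" using small[of 0 0] by simp
  have "n \<in> sum_set (prod_set A)" for n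
  proof (cases "n = 0")
    case True
    then show ?thesis using sumI[of 0 0 0 0] \<open>0 \<in> A\<close> by simp
  next
    case False
    then obtain v m where n: "n = 2 ^ v * m" "odd m" using exists_odd_part by blast
    show ?thesis
    proof (cases "m \<le> N")
      case True
      then have "m \<in> A" "2 ^ v \<in> A" using small[of m 0] small[OF \<open>N \<ge> 1\<close>, of v] by auto
      then show ?thesis using sumI[of "2 ^ v" m 0 0] \<open>0 \<in> A\<close> n by simp
    next
      case False
      have "m \<ge> 1" using n(2) by (simp add: odd_pos Suc_leI)
      then obtain k where k: "2 ^ k \<le> m" "m < 2 ^ (k + 1)"
        using ex_power_ivl1[of 2 m] by auto
      have "2 ^ 1024 < (2::nat) ^ (k + 1)" using False k unfolding N_def by linarith
      then have "1024 < k + 1" by (rule power_less_imp_less_exp[rotated]) simp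
      then have "16 \<le> k div 64" by simp
      then have "1 \<le> k div 64" by simp
      \<comment> \<open>As \<open>1024 = 64 * 16\<close>, the ranges of consecutive blocks meet, and
        this \<open>r\<close> is the block responsible for \<open>m\<close>.\<close>
      then obtain r where r: "16 ^ r \<le> k div 64" "k div 64 < 16 ^ (r + 1)"
        using ex_power_ivl1[of 16 "k div 64"] by auto
      have "r \<ge> 1"
      proof (rule ccontr)
        assume "\<not> 1 \<le> r"
        then have "r = 0" by simp
        then show False using r(2) \<open>16 \<le> k div 64\<close> by simp
      qed
      have rk: "64 * 16 ^ r \<le> k" "k + 1 \<le> 1024 * 16 ^ r" using r by auto
      have "(2::nat) ^ (64 * 16 ^ r) \<le> 2 ^ k" "(2::nat) ^ (k + 1) \<le> 2 ^ (1024 * 16 ^ r)"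
        using rk by (auto intro!: power_increasing simp del: power_Suc)
      then have "m \<in> sum_set (prod_set (S r))"
        using S(3)[OF \<open>r \<ge> 1\<close> n(2)] k by linarith
      then obtain a b c d where abcd: "a \<in> S r" "b \<in> S r" "c \<in> S r" "d \<in> S r" "m = a * b + c * d"
        unfolding sum_set_def prod_set_def by blast
      \<comment> \<open>The power of two goes to one factor of each product, where closure under
        doubling absorbs it.\<close>
      have "n = (2 ^ v * a) * b + (2 ^ v * c) * d" using n abcd by (simp add: algebra_simps)
      moreover have "2 ^ v * a \<in> A" "b \<in> A" "2 ^ v * c \<in> A" "d \<in> A"
        using block[OF \<open>r \<ge> 1\<close>, of a v] block[OF \<open>r \<ge> 1\<close>, of b 0]
          block[OF \<open>r \<ge> 1\<close>, of c v] block[OF \<open>r \<ge> 1\<close>, of d 0] abcd by simp_all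
      ultimately show ?thesis using sumI by simp
    qed
  qed
  then have "sum_set (prod_set A) = UNIV" by blast
  moreover have "(\<lambda>X. real (count_fun A X)) \<in> O(\<lambda>X. sqrt X / (ln X) powr (1/4))"
  proof (rule count_fun_bigo[of A "real N + 1" 262160 "112 * 262160"])
    show "real (card (A \<inter> {1..<2 ^ l})) \<le> (real N + 1) * l + 262160 * l ^ 2 * 2 powr (l / 4)
        + 112 * 262160 * (2 powr (l / 2) / l powr (1/4))" if "1 \<le> l" for l
      using card_doubling_closure_le[OF A_def S(1,2,4,5) that] by (simp add: algebra_simps)
  qed simp_all
  ultimately show ?thesis by blast
qed

end
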